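(* For every positive integer $n$, \[ \sum_{w\in \mathrm{FC}(B_n)} \mathbf{x}^{\mathrm{Des}_B(w)}\,\mathbf{z}^{\mathrm{Neg}(w)}\,q^{\mathrm{bl}(w^{-1})}\,t^{\,n-\mathrm{ldes}(w^{-1})} =\sum_{w\in \mathrm{FC}(B_n)} \mathbf{x}^{\mathrm{Des}_B(w)}\,\mathbf{z}^{\mathrm{Neg}(w)}\,q^{\,n-\mathrm{ldes}(w^{-1})}\,t^{\mathrm{bl}(w^{-1})}. \]
   Context: $B_n$ is the group of signed permutations of $\{\pm1,\ldots,\pm n\}$ ($w(-i)=-w(i)$), written $w=[w_1,\ldots,w_n]$, composed as functions. Coxeter generators: $s_0=[-1,2,\ldots,n]$, $s_i=[1,\ldots,i-1,i+1,i,i+2,\ldots,n]$ ($1\le i\le n-1$). An element is fully commutative (FC) if any reduced expression in these generators can be obtained from any other using only commutation relations $st=ts$ between commuting generators; $\mathrm{FC}(B_n)$ is the set of FC elements. With $w_0:=0$: $\mathrm{Des}_B(w)=\{0\le i\le n-1\mid w_i>w_{i+1}\}$; $\mathrm{ldes}(w)=\max\mathrm{Des}_B(w)$ (or $0$ if empty); $\mathrm{Neg}(w)=\{i\in[n]\mid w_i<0\}$; $\mathrm{bl}(w)=1+\#\{1\le i\le n-1\mid \max(w_1,\ldots,w_i)<\min(w_{i+1},\ldots,w_n)\}$. For a set $J$, $\mathbf{x}^J=\prod_{i\in J}x_i$, and similarly $\mathbf{z}^J$. *)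

theory Defs
  imports Main
begin

definition signed_perms :: "nat \<Rightarrow> (int \<Rightarrow> int) set" where
  "signed_perms n = {w. bij_betw w ({-int n..int n} - {0}) ({-int n..int n} - {0})
      \<and> (\<forall>i. w (-i) = - w i) \<and> (\<forall>i. \<bar>i\<bar> > int n \<longrightarrow> w i = i)}"

definition cox_gen :: "nat \<Rightarrow> int \<Rightarrow> int" where
  "cox_gen k = (if k = 0 then (\<lambda>j. if j = 1 then -1 else if j = -1 then 1 else j)
     else (\<lambda>j. if j = int k then int k + 1 else if j = int k + 1 then int k
              else if j = - int k then - int k - 1 else if j = - int k - 1 then - int k
              else j))"

definition word_prod :: "nat list \<Rightarrow> int \<Rightarrow> int" where
  "word_prod ws = foldr (\<lambda>a f. cox_gen a \<circ> f) ws id"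

definition gen_words :: "nat \<Rightarrow> nat list set" where
  "gen_words n = {ws. set ws \<subseteq> {0..<n}}"

definition reduced_word :: "nat \<Rightarrow> (int \<Rightarrow> int) \<Rightarrow> nat list \<Rightarrow> bool" where
  "reduced_word n w ws \<longleftrightarrow> ws \<in> gen_words n \<and> word_prod ws = w \<and>
     (\<forall>vs \<in> gen_words n. word_prod vs = w \<longrightarrow> length ws \<le> length vs)"

definition comm_move :: "nat list \<Rightarrow> nat list \<Rightarrow> bool" where
  "comm_move u v \<longleftrightarrow> (\<exists>p q a b. u = p @ [a, b] @ q \<and> v = p @ [b, a] @ q \<and>
      cox_gen a \<circ> cox_gen b = cox_gen b \<circ> cox_gen a)"

definition fully_commutative :: "nat \<Rightarrow> (int \<Rightarrow> int) \<Rightarrow> bool" where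
  "fully_commutative n w \<longleftrightarrow> (\<forall>u v. reduced_word n w u \<longrightarrow> reduced_word n w v \<longrightarrow>
      comm_move\<^sup>*\<^sup>* u v)"

definition FC :: "nat \<Rightarrow> (int \<Rightarrow> int) set" where
  "FC n = {w \<in> signed_perms n. fully_commutative n w}"

text \<open>Statistics; w_i = w i, and w_0 = w 0 = 0.\<close>

definition DesB :: "nat \<Rightarrow> (int \<Rightarrow> int) \<Rightarrow> nat set" where
  "DesB n w = {i. i \<le> n - 1 \<and> w (int i) > w (int i + 1)}"

definition ldes :: "nat \<Rightarrow> (int \<Rightarrow> int) \<Rightarrow> nat" where
  "ldes n w = (if DesB n w = {} then 0 else Max (DesB n w))"

definition Neg :: "nat \<Rightarrow> (int \<Rightarrow> int) \<Rightarrow> nat set" where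
  "Neg n w = {i. 1 \<le> i \<and> i \<le> n \<and> w (int i) < 0}"

definition bl :: "nat \<Rightarrow> (int \<Rightarrow> int) \<Rightarrow> nat" where
  "bl n w = 1 + card {i. 1 \<le> i \<and> i \<le> n - 1 \<and>
      Max (w ` {1..int i}) < Min (w ` {int i + 1..int n})}"

end

theory Submission
  imports Defs
begin

text \<open>
Write \<open>v = inv w\<close> as the list \<open>[v 1, \<dots>, v n]\<close>; letters at the left end of words for \<open>w\<close> act on
positions of this list. An element is fully commutative iff no list reached from it by undoing
descents has two adjacent descents \<open>a, a + 1\<close>, and peeling off the entry \<open>\<plusminus> n\<close> turns this into a generating
tree: the entry \<open>n + 1\<close> is inserted in front of an increasing suffix, the entry \<open>- (n + 1)\<close> either
in front of an increasing list or anywhere in the identity.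

Let \<open>b\<close> be the number of blocks, \<open>l\<close> the length of the last increasing run and \<open>m\<close> the number of
trailing singleton blocks. Appending \<open>n + 1\<close> maps \<open>(b, l, m)\<close> to \<open>(b + 1, l + 1, m + 1)\<close>;
inserting it before the last \<open>j \<le> l\<close> entries, \<open>j \<ge> 1\<close>, gives \<open>(b - min (j - 1) m, j, 0)\<close>. The
change of the descents and of the negative values depends on \<open>m\<close> only. If
\<open>H s\<close> denotes the antidiagonal \<open>{(i, s + 1 - i) | 1 \<le> i \<le> s}\<close>, then for each \<open>m\<close> and each value of
the descent and negative sets the pairs \<open>(b - m, l - m)\<close> form a union of copies of antidiagonals and of
the point \<open>(0, 0)\<close>: insertion with \<open>j \<ge> 1\<close> turns \<open>H s\<close> shifted by \<open>m\<close> into \<open>H (m + 1) + \<dots> + H (m + s)\<close>, and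
the point \<open>(m, m)\<close> into \<open>H m\<close>. All of these are symmetric.
\<close>

section \<open>Reduced words and weak order\<close>


definition signed_lists :: "nat \<Rightarrow> int list set" where
  "signed_lists n = {xs. length xs = n \<and> abs ` set xs = {1..int n}}"

text \<open>Left multiplication of \<open>w\<close> by a generator is right multiplication of
  \<open>inv w\<close>, so it acts on list positions; letter \<open>Suc k\<close> swaps the 0-based
  entries \<open>k\<close> and \<open>Suc k\<close>.\<close>

definition act :: "nat \<Rightarrow> int list \<Rightarrow> int list" where
  "act a xs = (case a of 0 \<Rightarrow> (case xs of [] \<Rightarrow> [] | y # ys \<Rightarrow> - y # ys)
     | Suc k \<Rightarrow> if Suc k < length xs then xs[k := xs ! Suc k, Suc k := xs ! k] else xs)"

definition desc :: "int list \<Rightarrow> nat \<Rightarrow> bool" where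
  "desc xs a = (case a of 0 \<Rightarrow> xs \<noteq> [] \<and> hd xs < 0 | Suc k \<Rightarrow> Suc k < length xs \<and> xs ! k > xs ! Suc k)"

fun inv_num :: "int list \<Rightarrow> nat" where
  "inv_num [] = 0"
| "inv_num (y # ys) = length (filter (\<lambda>u. u < y) ys) + inv_num ys"

text \<open>The known formula for the Coxeter length in type B: inversions plus the absolute values
  of the negative entries.\<close>

definition ell :: "int list \<Rightarrow> nat" where
  "ell xs = inv_num xs + sum_list (map (\<lambda>y. nat (- y)) xs)"

lemma act_0 [simp]: "act 0 [] = []" "act 0 (y # ys) = - y # ys"
  by (simp_all add: act_def)

lemma desc_0 [simp]: "\<not> desc [] a" "desc (y # ys) 0 \<longleftrightarrow> y < 0"
  by (auto simp: desc_def split: nat.splits)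

lemma act_Suc_append [simp]: "act (Suc (length ps)) (ps @ a # b # qs) = ps @ b # a # qs"
  by (simp add: act_def list_update_append nth_append)

lemma length_act [simp]: "length (act a xs) = length xs"
  by (auto simp: act_def split: nat.splits list.splits)

lemma desc_less: "desc xs a \<Longrightarrow> a < length xs"
  by (auto simp: desc_def split: nat.splits)

lemma split_at_two:
  assumes "Suc k < length xs"
  obtains ps a b qs where "xs = ps @ a # b # qs" "length ps = k"
proof
  show "xs = take k xs @ xs ! k # xs ! Suc k # drop (Suc (Suc k)) xs"
    using assms by (simp add: Cons_nth_drop_Suc)
  show "length (take k xs) = k" using assms by simp
qed

lemma desc_Suc_append [simp]: "desc (ps @ a # b # qs) (Suc (length ps)) \<longleftrightarrow> a > b"
  by (simp add: desc_def nth_append)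

lemma act_cases:
  assumes "a < length xs"
  obtains (zero) y ys where "a = 0" "xs = y # ys"
  | (Suc) ps b c qs where "a = Suc (length ps)" "xs = ps @ b # c # qs"
proof (cases a)
  case 0 then show ?thesis using assms zero by (cases xs) auto
next
  case (Suc k)
  then obtain ps b c qs where "xs = ps @ b # c # qs" "length ps = k" using assms split_at_two by metis
  then show ?thesis using that(2) Suc by blast
qed

lemma act_act [simp]: "act a (act a xs) = xs"
proof (cases "a < length xs")
  case True then show ?thesis by (cases rule: act_cases) auto
next
  case False then show ?thesis by (auto simp: act_def split: nat.splits list.splits)
qed

lemma signed_lists_act: "xs \<in> signed_lists n \<Longrightarrow> act a xs \<in> signed_lists n"
proof (cases "a < length xs")
  case True
  assume "xs \<in> signed_lists n"
  with True show ?thesis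
    by (cases rule: act_cases) (auto simp: signed_lists_def insert_commute)
next
  case False
  assume "xs \<in> signed_lists n"
  moreover have "act a xs = xs" using False by (auto simp: act_def split: nat.splits list.splits)
  ultimately show ?thesis by simp
qed

lemma signed_lists_distinct:
  assumes "xs \<in> signed_lists n"
  shows "distinct (map abs xs)"
  using assms by (intro card_distinct) (auto simp: signed_lists_def)

lemma signed_lists_distinct': "xs \<in> signed_lists n \<Longrightarrow> distinct xs"
  using signed_lists_distinct distinct_map by blast

lemma signed_lists_nonzero: "xs \<in> signed_lists n \<Longrightarrow> y \<in> set xs \<Longrightarrow> y \<noteq> 0"
  by (force simp: signed_lists_def)

lemma desc_act_iff:
  assumes "xs \<in> signed_lists n" "a < n"
  shows "desc (act a xs) a \<longleftrightarrow> \<not> desc xs a"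
proof -
  have l: "a < length xs" using assms by (simp add: signed_lists_def)
  from l show ?thesis
  proof (cases rule: act_cases)
    case zero then show ?thesis using signed_lists_nonzero[OF assms(1), of "hd xs"] by auto
  next
    case (Suc ps b c qs)
    then show ?thesis using signed_lists_distinct'[OF assms(1)] by auto
  qed
qed

lemma inv_num_swap:
  "b > c \<Longrightarrow> inv_num (ps @ b # c # qs) = Suc (inv_num (ps @ c # b # qs))"
  by (induction ps) auto

text \<open>Undoing a descent by a swap removes one inversion and keeps the negative entries. Making
  a first entry \<open>y < 0\<close> positive lowers the second summand by \<open>- y\<close>, while
  the new inversions come from the entries of smaller absolute value, of which there are
  \<open>- y - 1\<close>.\<close>

lemma ell_act:
  assumes "xs \<in> signed_lists n" "desc xs a"
  shows "ell xs = Suc (ell (act a xs))"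
proof -
  have l: "a < length xs" using desc_less[OF assms(2)] .
  from l show ?thesis
  proof (cases rule: act_cases)
    case (Suc ps b c qs)
    then show ?thesis using assms(2) by (simp add: ell_def inv_num_swap)
  next
    case (zero y ys)
    have y: "y < 0" using assms zero by simp
    have im: "abs ` set xs = {1..int n}" using assms by (simp add: signed_lists_def)
    have d: "distinct (map abs (y # ys))" using signed_lists_distinct[OF assms(1)] zero by simp
    let ?f = "filter (\<lambda>u. y \<le> u \<and> u < - y) ys"
    have "length (filter (\<lambda>u. u < - y) ys) = length (filter (\<lambda>u. u < y) ys) + length ?f"
      using y by (induction ys) auto
    moreover have "length ?f = nat (- y) - 1"
    proof -
      \<comment> \<open>Absolute values do not repeat, so the entries are counted by the set of
        their absolute values, an initial interval.\<close>
      have "distinct (map abs ?f)" using d by (simp add: distinct_map_filter)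
      then have "length ?f = card (abs ` set ?f)" by (metis distinct_card length_map set_map)
      also have "abs ` set ?f = {1..- y - 1}"
      proof
        show "abs ` set ?f \<subseteq> {1..- y - 1}"
        proof
          fix k assume "k \<in> abs ` set ?f"
          then obtain u where u: "u \<in> set ys" "y \<le> u" "u < - y" "k = \<bar>u\<bar>" by auto
          then have "u \<noteq> 0" "u \<noteq> y" using signed_lists_nonzero[OF assms(1)] signed_lists_distinct'[OF assms(1)] zero by auto
          then show "k \<in> {1..- y - 1}" using u by auto
        qed
        show "{1..- y - 1} \<subseteq> abs ` set ?f"
        proof
          fix k assume k: "k \<in> {1..- y - 1}"
          have "- y \<in> abs ` set xs" using zero y by force
          then have "k \<in> abs ` set xs" using k im by auto
          then obtain u where u: "u \<in> set xs" "k = \<bar>u\<bar>" by auto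
          then have "u \<in> set ys" "y \<le> u \<and> u < - y" using zero k by auto
          then show "k \<in> abs ` set ?f" using u by auto
        qed
      qed
      also have "card {1..- y - 1} = nat (- y) - 1" by (simp add: nat_diff_distrib)
      finally show ?thesis .
    qed
    ultimately show ?thesis using zero y by (simp add: ell_def)
  qed
qed

lemma ell_act_up:
  assumes "xs \<in> signed_lists n" "a < n" "\<not> desc xs a"
  shows "ell (act a xs) = Suc (ell xs)"
  using ell_act[OF signed_lists_act[OF assms(1)], of a a] desc_act_iff assms by simp

lemma upto_signed_lists: "[1..int n] \<in> signed_lists n"
  by (auto simp: signed_lists_def image_iff)

lemma no_desc_eq_upto:
  assumes "xs \<in> signed_lists n" "\<And>a. \<not> desc xs a"
  shows "xs = [1..int n]"
proof -
  have s: "sorted xs"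
    unfolding sorted_iff_nth_Suc using assms(2)
    by (metis (no_types, lifting) desc_def linorder_not_less nat.simps(5))
  have "y > 0" if "y \<in> set xs" for y
  proof -
    have "\<not> hd xs < 0" using assms(2)[of 0] that by (cases xs) auto
    moreover have "hd xs \<le> y" using s that by (cases xs) auto
    ultimately show ?thesis using signed_lists_nonzero[OF assms(1) that] by simp
  qed
  then have "abs ` set xs = set xs" by (force simp: image_iff)
  then have "set xs = set [1..int n]" using assms by (simp add: signed_lists_def)
  then show ?thesis using s signed_lists_distinct'[OF assms(1)]
    by (intro sorted_distinct_set_unique) auto
qed

lemma ell_upto: "ell [1..int n] = 0"
proof -
  have "inv_num ys = 0" if "sorted ys" for ys
    using that by (induction ys) (auto simp: filter_empty_conv)
  then show ?thesis by (simp add: ell_def)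
qed

section \<open>Words, their values and reduced words\<close>

definition eval_word :: "nat \<Rightarrow> nat list \<Rightarrow> int list" where
  "eval_word n ws = foldr act ws [1..int n]"

lemma eval_word_simps [simp]:
  "eval_word n [] = [1..int n]" "eval_word n (a # ws) = act a (eval_word n ws)"
  by (simp_all add: eval_word_def)

lemma gen_words_Cons [simp]: "a # ws \<in> gen_words n \<longleftrightarrow> a < n \<and> ws \<in> gen_words n"
  by (auto simp: gen_words_def)

lemma gen_words_Nil [simp]: "[] \<in> gen_words n"
  by (simp add: gen_words_def)

lemma eval_word_signed: "eval_word n ws \<in> signed_lists n"
  by (induction ws) (auto simp: upto_signed_lists signed_lists_act)

lemma ell_eval_word_le: "ws \<in> gen_words n \<Longrightarrow> ell (eval_word n ws) \<le> length ws"
proof (induction ws)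
  case Nil then show ?case by (simp add: ell_upto)
next
  case (Cons a ws)
  then show ?case using ell_act[OF eval_word_signed, of n ws a] ell_act_up[OF eval_word_signed, of a n ws]
    by (cases "desc (eval_word n ws) a") auto
qed

text \<open>Length \<open>ell xs\<close> is the least possible by \<open>ell_eval_word_le\<close>;
  agreement with \<open>reduced_word\<close> is \<open>reduced_word_iff\<close>.\<close>

definition red :: "nat \<Rightarrow> int list \<Rightarrow> nat list set" where
  "red n xs = {ws \<in> gen_words n. eval_word n ws = xs \<and> length ws = ell xs}"

lemma red_exists: "xs \<in> signed_lists n \<Longrightarrow> \<exists>ws. ws \<in> red n xs"
proof (induction "ell xs" arbitrary: xs rule: less_induct)
  case less
  show ?case
  proof (cases "\<exists>a. desc xs a")
    case False
    then have "xs = [1..int n]" using no_desc_eq_upto less.prems by blast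
    then show ?thesis by (intro exI[of _ "[]"]) (simp add: red_def ell_upto)
  next
    case True
    then obtain a where a: "desc xs a" by blast
    have e: "ell xs = Suc (ell (act a xs))" using ell_act less.prems a by blast
    then obtain ws where "ws \<in> red n (act a xs)"
      using less.hyps[of "act a xs"] signed_lists_act less.prems by auto
    moreover have "a < n" using desc_less[OF a] less.prems by (simp add: signed_lists_def)
    ultimately show ?thesis using e by (intro exI[of _ "a # ws"]) (auto simp: red_def)
  qed
qed

text \<open>If \<open>a\<close> were not a descent, \<open>act a xs\<close> would have length
  \<open>ell xs + 1\<close>, too long for the word \<open>ws\<close>. Hence reduced words can be
  studied by walking down the weak order.\<close>

lemma red_Cons:
  assumes "xs \<in> signed_lists n"
  shows "a # ws \<in> red n xs \<longleftrightarrow> desc xs a \<and> ws \<in> red n (act a xs)"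
proof
  assume r: "a # ws \<in> red n xs"
  then have a: "a < n" and ws: "ws \<in> gen_words n" "eval_word n ws = act a xs"
    by (auto simp: red_def)
  have le: "ell (act a xs) \<le> length ws" using ell_eval_word_le[OF ws(1)] ws by simp
  have "desc xs a"
  proof (rule ccontr)
    assume "\<not> desc xs a"
    then have "ell (act a xs) = Suc (ell xs)" using ell_act_up assms a by blast
    then show False using le r by (simp add: red_def)
  qed
  moreover have "ell xs = Suc (ell (act a xs))" using ell_act assms calculation by blast
  ultimately show "desc xs a \<and> ws \<in> red n (act a xs)" using r ws by (simp add: red_def)
next
  assume r: "desc xs a \<and> ws \<in> red n (act a xs)"
  then have "ell xs = Suc (ell (act a xs))" "a < n"
    using ell_act[OF assms] desc_less[of xs a] assms by (auto simp: signed_lists_def)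
  then show "a # ws \<in> red n xs" using r by (simp add: red_def)
qed

lemma red_Nil: "[] \<in> red n xs \<Longrightarrow> ws \<in> red n xs \<Longrightarrow> ws = []"
  by (simp add: red_def)

section \<open>Commutation moves and a descent criterion for full commutativity\<close>

lemma comm_move_Cons: "comm_move u v \<Longrightarrow> comm_move (a # u) (a # v)"
  unfolding comm_move_def by (metis append_Cons)

lemma comm_moves_Cons: "comm_move\<^sup>*\<^sup>* u v \<Longrightarrow> comm_move\<^sup>*\<^sup>* (a # u) (a # v)"
  by (induction rule: rtranclp_induct) (auto intro: rtranclp.rtrancl_into_rtrancl comm_move_Cons)

lemma cox_gen_commute:
  assumes "Suc a < b"
  shows "cox_gen a \<circ> cox_gen b = cox_gen b \<circ> cox_gen a"
  using assms by (auto simp: cox_gen_def fun_eq_iff)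

lemma cox_gen_not_commute: "cox_gen a \<circ> cox_gen (Suc a) \<noteq> cox_gen (Suc a) \<circ> cox_gen a"
proof
  assume "cox_gen a \<circ> cox_gen (Suc a) = cox_gen (Suc a) \<circ> cox_gen a"
  \<comment> \<open>The test point is 1 for \<open>a = 0\<close>, with images 2 and -2, and
    otherwise \<open>a\<close>, with images \<open>a + 1\<close> and \<open>a + 2\<close>. The point
    0 is fixed by every generator and would not do.\<close>
  then have "(cox_gen a \<circ> cox_gen (Suc a)) (max 1 (int a)) = (cox_gen (Suc a) \<circ> cox_gen a) (max 1 (int a))"
    by simp
  then show False by (cases a) (auto simp: cox_gen_def)
qed

text \<open>Neighbouring generators do not commute, so no move exchanges them: the subword on these
  two letters is an invariant of the commutation class.\<close>

lemma comm_move_filter: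
  assumes "comm_move u v"
  shows "filter (\<lambda>c. c = a \<or> c = Suc a) u = filter (\<lambda>c. c = a \<or> c = Suc a) v"
  using assms cox_gen_not_commute[of a] unfolding comm_move_def by auto

lemma comm_moves_filter:
  "comm_move\<^sup>*\<^sup>* u v \<Longrightarrow> filter (\<lambda>c. c = a \<or> c = Suc a) u = filter (\<lambda>c. c = a \<or> c = Suc a) v"
  by (induction rule: rtranclp_induct) (auto dest: comm_move_filter)

text \<open>Serves to cancel a common first letter. A move that involves the deleted occurrence
  becomes trivial, hence the reflexive closure.\<close>

lemma comm_move_remove1:
  assumes "comm_move u v"
  shows "comm_move\<^sup>*\<^sup>* (remove1 c u) (remove1 c v)"
proof -
  from assms obtain p q a b where
    uv: "u = p @ [a, b] @ q" "v = p @ [b, a] @ q" and ab: "cox_gen a \<circ> cox_gen b = cox_gen b \<circ> cox_gen a"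
    unfolding comm_move_def by blast
  have mv: "comm_move\<^sup>*\<^sup>* (p' @ [a, b] @ q') (p' @ [b, a] @ q')" for p' q'
    using ab unfolding comm_move_def by blast
  show ?thesis
    using uv mv[of "remove1 c p" q] mv[of p "remove1 c q"] by (auto simp: remove1_append)
qed

lemma comm_moves_remove1: "comm_move\<^sup>*\<^sup>* u v \<Longrightarrow> comm_move\<^sup>*\<^sup>* (remove1 c u) (remove1 c v)"
  by (induction rule: rtranclp_induct) (auto dest: comm_move_remove1 intro: rtranclp_trans)

definition fc :: "nat \<Rightarrow> int list \<Rightarrow> bool" where
  "fc n xs \<longleftrightarrow> (\<forall>u\<in>red n xs. \<forall>v\<in>red n xs. comm_move\<^sup>*\<^sup>* u v)"

text \<open>Two adjacent descents would let reduced words start with either of two noncommuting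
  letters; this is forbidden at every list below \<open>xs\<close> in weak order. Undoing a descent
  of a signed list lowers \<open>ell\<close>, so the recursion is well founded there.\<close>

inductive sparse :: "int list \<Rightarrow> bool" where
  "(\<And>a. desc xs a \<Longrightarrow> \<not> desc xs (Suc a)) \<Longrightarrow> (\<And>a. desc xs a \<Longrightarrow> sparse (act a xs)) \<Longrightarrow> sparse xs"

lemma act_commute:
  assumes "Suc a < b" shows "act a (act b xs) = act b (act a xs)"
proof (cases a)
  case 0
  with assms show ?thesis
    by (cases b; cases "b - 1"; cases xs) (auto simp: act_def)
next
  case (Suc k)
  with assms obtain l where "b = Suc l" "Suc k < l" by (cases b) auto
  with Suc show ?thesis
    by (auto simp: act_def nth_list_update list_update_swap intro!: nth_equalityI)
qed

lemma desc_act_far: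
  assumes "Suc a < b" shows "desc (act a xs) b = desc xs b" "desc (act b xs) a = desc xs a"
  using assms
   by (auto simp: act_def desc_def nth_list_update hd_conv_nth nth_Cons split: nat.splits list.splits)

text \<open>A diamond argument: reduced words with different first letters \<open>a\<close>,
  \<open>b\<close> start with nonadjacent, hence commuting, descents, and both are connected to
  words that differ by one move at the front.\<close>

lemma sparse_imp_fc:
  assumes "sparse xs" "xs \<in> signed_lists n"
  shows "fc n xs"
  using assms
proof (induction rule: sparse.induct)
  case (1 xs)
  have IH: "comm_move\<^sup>*\<^sup>* u v" if "desc xs a" "u \<in> red n (act a xs)" "v \<in> red n (act a xs)" for a u v
    using 1(3)[OF that(1) signed_lists_act[OF 1(4)]] that by (auto simp: fc_def)
  have far: "comm_move\<^sup>*\<^sup>* (a # u) (b # v) \<and> comm_move\<^sup>*\<^sup>* (b # v) (a # u)"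
    if "Suc a < b" "a # u \<in> red n xs" "b # v \<in> red n xs" for a b u v
  proof -
    have da: "desc xs a" "u \<in> red n (act a xs)" and db: "desc xs b" "v \<in> red n (act b xs)"
      using that red_Cons[OF 1(4)] by auto
    \<comment> \<open>With \<open>r\<close> a reduced word for the list below both, the words
      \<open>a # b # r\<close> and \<open>b # a # r\<close> are the middle of the chain; the
      induction hypothesis supplies its two ends.\<close>
    obtain r where r: "r \<in> red n (act a (act b xs))"
      using red_exists[OF signed_lists_act[OF signed_lists_act[OF 1(4)]]] by blast
    have ar: "a # r \<in> red n (act b xs)" and br: "b # r \<in> red n (act a xs)"
      using red_Cons[OF signed_lists_act[OF 1(4)]] r act_commute[OF that(1)] da db desc_act_far[OF that(1)]
      by auto
    have "comm_move (a # b # r) (b # a # r)" "comm_move (b # a # r) (a # b # r)"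
      using cox_gen_commute[OF that(1)] unfolding comm_move_def by (metis append_Cons append_Nil)+
    then show ?thesis
      using IH[OF da br] IH[OF da(1) br da(2)] IH[OF db ar] IH[OF db(1) ar db(2)]
      by (meson comm_moves_Cons r_into_rtranclp rtranclp_trans)
  qed
  show ?case unfolding fc_def
  proof (intro ballI)
    fix u v assume uv: "u \<in> red n xs" "v \<in> red n xs"
    show "comm_move\<^sup>*\<^sup>* u v"
    proof (cases "u = [] \<or> v = []")
      case True then show ?thesis using uv red_Nil by (metis rtranclp.rtrancl_refl)
    next
      case False
      then obtain a u' b v' where e: "u = a # u'" "v = b # v'" by (metis list.exhaust)
      have d: "desc xs a" "desc xs b" "u' \<in> red n (act a xs)" "v' \<in> red n (act b xs)"
        using uv e red_Cons[OF 1(4)] by auto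
      have "b \<noteq> Suc a" "a \<noteq> Suc b" using 1(1) d by auto
      then consider "a = b" | "Suc a < b" | "Suc b < a" by linarith
      then show ?thesis
      proof cases
        case 1 then show ?thesis using IH d e comm_moves_Cons by blast
      next
        case 2 then show ?thesis using far uv e by blast
      next
        case 3 then show ?thesis using far uv e by blast
      qed
    qed
  qed
qed

text \<open>Words starting with \<open>a\<close> and \<open>Suc a\<close> differ in the invariant
  subword, which excludes adjacent descents; cancelling the first letter passes full commutativity
  on to \<open>act a xs\<close>.\<close>

lemma fc_imp_sparse: "fc n xs \<Longrightarrow> xs \<in> signed_lists n \<Longrightarrow> sparse xs"
proof (induction "ell xs" arbitrary: xs rule: less_induct)
  case less
  show ?case
  proof
    fix a assume d: "desc xs a"
    obtain u where u: "a # u \<in> red n xs"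
      using red_exists[OF signed_lists_act[OF less.prems(2)]] red_Cons[OF less.prems(2)] d by blast
    show "\<not> desc xs (Suc a)"
    proof
      assume "desc xs (Suc a)"
      then obtain v where v: "Suc a # v \<in> red n xs"
        using red_exists[OF signed_lists_act[OF less.prems(2)]] red_Cons[OF less.prems(2)] by blast
      then have "comm_move\<^sup>*\<^sup>* (a # u) (Suc a # v)" using u less.prems(1) by (simp add: fc_def)
      from comm_moves_filter[OF this, of a] show False by simp
    qed
    have "fc n (act a xs)"
      unfolding fc_def
    proof (intro ballI)
      fix u v assume "u \<in> red n (act a xs)" "v \<in> red n (act a xs)"
      then have "comm_move\<^sup>*\<^sup>* (a # u) (a # v)"
        using less.prems d red_Cons[OF less.prems(2)] by (simp add: fc_def)
      from comm_moves_remove1[OF this, of a] show "comm_move\<^sup>*\<^sup>* u v" by simp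
    qed
    then show "sparse (act a xs)"
      using less.hyps ell_act[OF less.prems(2) d] signed_lists_act less.prems(2) by simp
  qed
qed


section \<open>The generating tree\<close>

inductive good :: "nat \<Rightarrow> int list \<Rightarrow> bool" where
  Nil: "good 0 []"
| pos: "good n (ys @ zs) \<Longrightarrow> sorted zs \<Longrightarrow> good (Suc n) (ys @ (int n + 1) # zs)"
| neg_front: "good n zs \<Longrightarrow> sorted zs \<Longrightarrow> good (Suc n) (- (int n + 1) # zs)"
| neg_inner: "ys @ zs = [1..int n] \<Longrightarrow> good (Suc n) (ys @ - (int n + 1) # zs)"

lemma insert_atLeastAtMost_int: "insert (int n + 1) {1..int n} = {1..int (Suc n)}"
  by auto

lemma signed_lists_insert_iff:
  assumes "\<bar>y\<bar> = int n + 1"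
  shows "ys @ y # zs \<in> signed_lists (Suc n) \<longleftrightarrow> ys @ zs \<in> signed_lists n"
proof
  assume s: "ys @ zs \<in> signed_lists n"
  have "abs ` set (ys @ y # zs) = insert (int n + 1) (abs ` set (ys @ zs))" using assms by auto
  with s show "ys @ y # zs \<in> signed_lists (Suc n)"
    by (simp add: signed_lists_def insert_atLeastAtMost_int del: set_append)
next
  assume s: "ys @ y # zs \<in> signed_lists (Suc n)"
  have eq: "insert (int n + 1) (abs ` set (ys @ zs)) = {1..int (Suc n)}"
    using s assms by (auto simp: signed_lists_def)
  have "int n + 1 \<notin> abs ` set (ys @ zs)" using signed_lists_distinct[OF s] assms by auto
  then have "abs ` set (ys @ zs) = {1..int (Suc n)} - {int n + 1}" using eq by blast
  also have "\<dots> = {1..int n}" by auto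
  finally show "ys @ zs \<in> signed_lists n" using s by (simp add: signed_lists_def)
qed

lemma good_signed: "good n xs \<Longrightarrow> xs \<in> signed_lists n"
proof (induction rule: good.induct)
  case Nil then show ?case by (simp add: signed_lists_def)
next
  case (pos n ys zs) then show ?case by (simp add: signed_lists_insert_iff)
next
  case (neg_front n zs) then show ?case using signed_lists_insert_iff[of "- (int n + 1)" n "[]" zs] by simp
next
  case (neg_inner ys zs n)
  then show ?case by (simp add: signed_lists_insert_iff upto_signed_lists)
qed

lemma signed_lists_bound: "xs \<in> signed_lists n \<Longrightarrow> y \<in> set xs \<Longrightarrow> \<bar>y\<bar> \<le> int n"
  by (force simp: signed_lists_def)

lemma good_bound: "good n xs \<Longrightarrow> y \<in> set xs \<Longrightarrow> \<bar>y\<bar> \<le> int n"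
  using good_signed signed_lists_bound by blast

lemma split_unique:
  assumes "ys @ y # zs = ys' @ y # zs'" "y \<notin> set (ys' @ zs')"
  shows "ys = ys' \<and> zs = zs'"
  using assms append_Cons_eq_iff[of y ys' zs' ys zs] by simp

text \<open>The entry \<open>int n + 1\<close> occurs only once, so the given split around it is the
  one of the introduction rule.\<close>

lemma good_posD:
  assumes "good (Suc n) (ys @ (int n + 1) # zs)"
  shows "good n (ys @ zs)" "sorted zs"
proof -
  have "good n (ys @ zs) \<and> sorted zs"
    using assms
  proof (cases rule: good.cases)
    case (pos ys' zs')
    then have "ys = ys' \<and> zs = zs'" by (intro split_unique) (auto dest: good_bound)
    then show ?thesis using pos by simp
  next
    case (neg_front zs')
    then have "int n + 1 \<in> set (- (int n + 1) # zs')" by (metis in_set_conv_decomp)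
    then show ?thesis using neg_front by (auto dest: good_bound)
  next
    case (neg_inner ys' zs')
    then have "int n + 1 \<in> set (ys' @ - (int n + 1) # zs')" by (metis in_set_conv_decomp)
    then have "int n + 1 \<in> set (ys' @ zs')" by auto
    then show ?thesis using neg_inner by simp
  qed
  then show "good n (ys @ zs)" "sorted zs" by auto
qed

lemma sorted_Cons_lower:
  assumes "zs \<in> signed_lists n"
  shows "sorted (- (int n + 1) # zs) \<longleftrightarrow> sorted zs"
  using signed_lists_bound[OF assms] by fastforce

lemma good_upto: "good n [1..int n]"
proof (induction n)
  case 0 then show ?case by (simp add: good.Nil)
next
  case (Suc n)
  then have "good (Suc n) ([1..int n] @ [int n + 1])" using good.pos[of n _ "[]"] by simp
  then show ?case by (simp add: upto_rec2 add.commute)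
qed

lemma good_negD:
  assumes "good (Suc n) (ys @ - (int n + 1) # zs)"
  shows "good n (ys @ zs) \<and> sorted (ys @ zs) \<and> (ys = [] \<or> ys @ zs = [1..int n])"
  using assms
proof (cases rule: good.cases)
  case (pos ys' zs')
  then have "- (int n + 1) \<in> set (ys' @ (int n + 1) # zs')" by (metis in_set_conv_decomp)
  then have "- (int n + 1) \<in> set (ys' @ zs')" by auto
  then show ?thesis using pos good_bound by fastforce
next
  case (neg_front zs')
  then have "ys = [] \<and> zs = zs'"
    using split_unique[of ys "- (int n + 1)" zs "[]" zs'] good_bound[of n zs' "- (int n + 1)"] by auto
  then show ?thesis using neg_front by simp
next
  case (neg_inner ys' zs')
  then have "ys = ys' \<and> zs = zs'"
    using split_unique[of ys "- (int n + 1)" zs ys' zs'] good_bound[OF good_upto, of "- (int n + 1)" n]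
    by auto
  then show ?thesis using neg_inner good_upto by simp
qed

section \<open>Descents after inserting an extreme entry, and equivalence of \<open>good\<close>
  with \<open>sparse\<close>\<close>

lemma desc_append: "a < length ys \<Longrightarrow> desc (ys @ zs) a = desc ys a"
  by (auto simp: desc_def nth_append split: nat.splits)

lemma act_append: "a < length ys \<Longrightarrow> act a (ys @ zs) = act a ys @ zs"
  by (cases ys) (auto simp: act_def nth_append list_update_append split: nat.splits)

lemma sorted_not_desc_Suc: "sorted xs \<Longrightarrow> \<not> desc xs (Suc k)"
  by (auto simp: desc_def sorted_iff_nth_Suc dest: leD)

text \<open>The step up to the maximum is no descent, also at position 0 because
  \<open>0 < m\<close>, and the increasing tail has none inside.\<close>

lemma desc_insert_max:
  assumes "\<And>y. y \<in> set ys \<Longrightarrow> y < m" "0 < m" "sorted zs" "desc (ys @ m # zs) a"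
  shows "a < length ys \<or> (a = Suc (length ys) \<and> zs \<noteq> [])"
proof (rule ccontr)
  assume n: "\<not> ?thesis"
  have l: "a < length ys + Suc (length zs)" using desc_less[OF assms(4)] by simp
  consider "a = length ys" | b where "a = length ys + Suc (Suc b)"
    using n l by (metis add_Suc_right less_imp_Suc_add linorder_neqE_nat list.size(3) Nat.add_0_right Suc_lessI less_irrefl_nat)
  then show False
  proof cases
    case 1
    then show ?thesis using assms(1)[of "last ys"] assms(2,4)
      by (cases ys rule: rev_cases) (auto simp: desc_def nth_append split: nat.splits)
  next
    case 2
    then have "Suc b < length zs" "zs ! b > zs ! Suc b"
      using assms(4) by (auto simp: desc_def nth_append)
    then show ?thesis using assms(3) by (meson linorder_not_less sorted_iff_nth_Suc)
  qed
qed

text \<open>The increasing list has no descent of its own, so only the step down to the minimum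
  remains; for \<open>ys = []\<close> this is the sign descent 0.\<close>

lemma desc_insert_min:
  assumes "\<And>y. y \<in> set (ys @ zs) \<Longrightarrow> m < y" "m < 0" "sorted (ys @ zs)" "desc (ys @ m # zs) a"
    "\<And>y. y \<in> set ys \<Longrightarrow> 0 < y"
  shows "a = length ys"
proof (cases a)
  case 0
  then show ?thesis using assms(4) assms(5)[of "hd ys"] by (cases ys) (auto simp: desc_def)
next
  case (Suc k)
  then have "Suc k < length (ys @ m # zs)" "(ys @ m # zs) ! k > (ys @ m # zs) ! Suc k"
    using assms(4) by (auto simp: desc_def)
  moreover have "sorted ys" "sorted (m # zs)" using assms by (auto simp: sorted_append intro: less_imp_le)
  moreover have "(m # zs) ! (k - length ys) \<le> (m # zs) ! Suc (k - length ys)"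
    if "length ys \<le> k" "Suc k < length (ys @ m # zs)"
    using that \<open>sorted (m # zs)\<close> sorted_nth_mono[of "m # zs" "k - length ys" "Suc (k - length ys)"]
    by (simp del: sorted_simps nth_Cons_Suc)
  ultimately show ?thesis using Suc
    by (cases "Suc k < length ys"; cases "k < length ys")
       (auto simp: nth_append not_less_eq sorted_iff_nth_Suc Suc_diff_le simp del: sorted_simps nth_Cons_Suc
         dest: leD)
qed

text \<open>Undoing a descent stays in the tree: inside \<open>ys\<close> it acts on the parent;
  behind the maximum it moves the maximum one place to the right; a negative extreme entry moves
  left through the identity and changes sign once it is in front.\<close>

lemma good_act_and_sparse:
  assumes "good n xs" "desc xs a"
  shows "good n (act a xs) \<and> \<not> desc xs (Suc a)"
  using assms
proof (induction arbitrary: a rule: good.induct)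
  case Nil
  then show ?case by simp
next
  case (pos n ys zs)
  have lt: "y < int n + 1" if "y \<in> set (ys @ zs)" for y using good_bound[OF pos.hyps(1) that] by simp
  have d: "b < length ys \<or> (b = Suc (length ys) \<and> zs \<noteq> [])" if "desc (ys @ (int n + 1) # zs) b" for b
    using desc_insert_max[of ys "int n + 1" zs b] lt that pos.hyps by auto
  from d[OF pos.prems] show ?case
  proof (elim disjE conjE)
    assume a: "a < length ys"
    then have "desc (ys @ zs) a" using pos.prems by (simp add: desc_append)
    note IH = pos.IH[OF this]
    have "good (Suc n) (act a (ys @ (int n + 1) # zs))"
      using IH a good.pos[of n "act a ys" zs] pos.hyps(2) by (simp add: act_append)
    moreover have "\<not> desc (ys @ (int n + 1) # zs) (Suc a)"
    proof
      assume D: "desc (ys @ (int n + 1) # zs) (Suc a)"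
      then have "Suc a < length ys" using d[OF D] a by auto
      then show False using IH D by (simp add: desc_append)
    qed
    ultimately show ?thesis by simp
  next
    assume a: "a = Suc (length ys)" "zs \<noteq> []"
    then obtain c zs' where zs: "zs = c # zs'" by (cases zs) auto
    have "good (Suc n) ((ys @ [c]) @ (int n + 1) # zs')"
      using good.pos[of n "ys @ [c]" zs'] pos.hyps zs by simp
    then show ?thesis using a zs d[of "Suc a"] by auto
  qed
next
  case (neg_front n zs)
  have "b = 0" if "desc (- (int n + 1) # zs) b" for b
    using desc_insert_min[of "[]" zs "- (int n + 1)" b] that neg_front.hyps good_bound[OF neg_front.hyps(1)]
    by fastforce
  then show ?case using neg_front.prems neg_front.hyps good.pos[of n "[]" zs]
    by (metis act_0(2) append_Nil minus_minus nat.distinct(1))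
next
  case (neg_inner ys zs n)
  have p: "0 < y" "- (int n + 1) < y" if "y \<in> set (ys @ zs)" for y
    using that neg_inner.hyps by auto
  have s: "sorted (ys @ zs)" using neg_inner.hyps by simp
  have d: "b = length ys" if "desc (ys @ - (int n + 1) # zs) b" for b
    using desc_insert_min[of ys zs "- (int n + 1)" b] p s that by auto
  have "good (Suc n) (act (length ys) (ys @ - (int n + 1) # zs))"
  proof (cases ys rule: rev_cases)
    case Nil
    have "sorted zs" using s by (simp add: sorted_append)
    then show ?thesis using Nil neg_inner.hyps good.pos[of n "[]" zs] good_upto[of n] by (simp add: add.commute)
  next
    case (snoc ys' y)
    then show ?thesis using good.neg_inner[of ys' "y # zs" n] neg_inner.hyps by simp
  qed
  then show ?case using d[OF neg_inner.prems] d[of "Suc a"] by auto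
qed

lemma good_imp_sparse: "good n xs \<Longrightarrow> sparse xs"
proof (induction "ell xs" arbitrary: xs rule: less_induct)
  case less
  show ?case
  proof
    fix a assume d: "desc xs a"
    show "\<not> desc xs (Suc a)" using good_act_and_sparse[OF less.prems d] by blast
    show "sparse (act a xs)"
      using less.hyps[of "act a xs"] good_act_and_sparse[OF less.prems d]
        ell_act[OF good_signed[OF less.prems] d] by simp
  qed
qed

text \<open>Descents at positions below \<open>length ys\<close> do not see the last entry, so the
  recursion for \<open>ys @ [m]\<close> contains the one for \<open>ys\<close>.\<close>

lemma sparse_butlast:
  assumes "sparse (ys @ [m])" "\<And>y. y \<in> set ys \<Longrightarrow> \<bar>y\<bar> < m"
  shows "sparse ys"
  using assms
proof (induction "ys @ [m]" arbitrary: ys rule: sparse.induct)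
  case (1 ys)
  show ?case
  proof
    fix a assume d: "desc ys a"
    have a: "a < length ys" using d desc_less by blast
    have d': "desc (ys @ [m]) a" using d a by (simp add: desc_append)
    show "\<not> desc ys (Suc a)"
      using 1(1)[OF d'] desc_less[of ys "Suc a"] desc_append[of "Suc a" ys "[m]"] by blast
    have "y \<in> set (act a ys) \<Longrightarrow> \<bar>y\<bar> < m" for y
      using a 1(4) by (cases rule: act_cases) auto
    then show "sparse (act a ys)" using 1(3)[OF d', of "act a ys"] a by (simp add: act_append)
  qed
qed

text \<open>The outer induction removes the entry of largest absolute value, the inner one undoes a
  descent at that entry. Inverting the \<open>good\<close> list so obtained shows what the rest of
  \<open>xs\<close> looks like.\<close>

lemma sparse_imp_good: "sparse xs \<Longrightarrow> xs \<in> signed_lists n \<Longrightarrow> good n xs"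
proof (induction n arbitrary: xs)
  case 0
  then show ?case by (simp add: signed_lists_def good.Nil)
next
  case (Suc n)
  from Suc.prems show ?case
  proof (induction rule: sparse.induct)
    case (1 xs)
    let ?N = "int n + 1"
    have IH: "good (Suc n) (act a xs)" if "desc xs a" for a
      using 1(3)[OF that signed_lists_act[OF 1(4)]] .
    have "?N \<in> abs ` set xs" using 1(4) by (simp add: signed_lists_def)
    then obtain y where y: "y \<in> set xs" "?N = \<bar>y\<bar>" by blast
    then have "y = ?N \<or> y = - ?N" by linarith
    then have "?N \<in> set xs \<or> - ?N \<in> set xs" using y by blast
    then show ?case
    proof
      assume "?N \<in> set xs"
      then obtain ys zs where xs: "xs = ys @ ?N # zs" by (meson split_list)
      have sl: "ys @ zs \<in> signed_lists n" using 1(4) xs by (simp add: signed_lists_insert_iff)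
      show ?thesis
      proof (cases zs)
        case Nil
        have "sparse xs" using 1(1,2) by (rule sparse.intros)
        then have "sparse ys" using xs Nil sparse_butlast[of ys ?N] signed_lists_bound[OF sl] by fastforce
        then have "good n (ys @ [])" using Suc.IH sl Nil by simp
        then show ?thesis using good.pos xs Nil by fastforce
      next
        case (Cons c zs')
        have "c < ?N" using signed_lists_bound[OF sl, of c] Cons by simp
        then have d: "desc xs (Suc (length ys))" using xs Cons by simp
        have "good (Suc n) ((ys @ [c]) @ ?N # zs')" using IH[OF d] xs Cons by simp
        note g = good_posD[OF this]
        have "sorted (c # zs')"
        proof (cases zs')
          case Nil then show ?thesis by simp
        next
          case (Cons e zs'')
          \<comment> \<open>A drop from \<open>c\<close> to \<open>e\<close> would give two adjacent
            descents \<open>?N > c > e\<close>.\<close>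
          have "\<not> desc xs (Suc (length (ys @ [?N])))" using 1(1)[OF d] by simp
          then have "c \<le> e" using xs \<open>zs = c # zs'\<close> Cons desc_Suc_append[of "ys @ [?N]" c e zs''] by simp
          then show ?thesis using g(2) Cons by auto
        qed
        then show ?thesis using good.pos[of n ys zs] g(1) xs Cons by simp
      qed
    next
      assume "- ?N \<in> set xs"
      then obtain ys zs where xs: "xs = ys @ - ?N # zs" by (meson split_list)
      have sl: "ys @ zs \<in> signed_lists n" using 1(4) xs by (simp add: signed_lists_insert_iff)
      show ?thesis
      proof (cases ys rule: rev_cases)
        case Nil
        then have d: "desc xs 0" using xs by simp
        have "good (Suc n) ([] @ ?N # zs)" using IH[OF d] xs Nil by (simp add: add.commute)
        from good_posD[OF this] show ?thesis using good.neg_front xs Nil by simp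
      next
        case (snoc ys' c)
        have c: "- ?N < c" using signed_lists_bound[OF sl, of c] snoc by simp
        then have d: "desc xs (Suc (length ys'))" using xs snoc by simp
        have "good (Suc n) (ys' @ - ?N # c # zs)" using IH[OF d] xs snoc by simp
        note g = good_negD[OF this]
        have "ys @ zs = [1..int n]"
        proof (rule ccontr)
          assume "ys @ zs \<noteq> [1..int n]"
          then have e: "ys' = []" using g snoc by auto
          then have s: "sorted (ys @ zs)" using g snoc by simp
          \<comment> \<open>A negative \<open>c\<close> in front of \<open>- ?N\<close> would make 0
            and 1 descents at once.\<close>
          have "\<not> c < 0" using 1(1)[of 0] d e xs snoc by auto
          then have "\<not> desc (ys @ zs) a" for a
            using s e snoc sorted_not_desc_Suc[OF s] by (cases a) auto
          then show False using no_desc_eq_upto[OF sl] \<open>ys @ zs \<noteq> [1..int n]\<close> by blast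
        qed
        then show ?thesis using good.neg_inner xs by simp
      qed
    qed
  qed
qed

lemma fc_iff_good: "xs \<in> signed_lists n \<Longrightarrow> fc n xs \<longleftrightarrow> good n xs"
  using fc_imp_sparse sparse_imp_fc sparse_imp_good good_imp_sparse by blast

section \<open>From signed permutations to lists\<close>

definition window_inv :: "nat \<Rightarrow> (int \<Rightarrow> int) \<Rightarrow> int list" where
  "window_inv n w = map (inv w) [1..int n]"

lemma odd_zero: "(\<forall>i. w (- i) = - w i) \<Longrightarrow> w (0::int) = (0::int)"
  by (metis add.inverse_neutral equal_neg_zero)

text \<open>Makes \<open>inv\<close> a genuine inverse on all integers: outside the window
  \<open>w\<close> is the identity, and 0 is fixed by oddness.\<close>

lemma signed_perms_bij:
  assumes "w \<in> signed_perms n"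
  shows "bij w"
proof -
  let ?A = "{-int n..int n} - {0}"
  have z: "w 0 = 0" using assms odd_zero[of w] by (simp add: signed_perms_def)
  have "w i = i" if "i \<notin> ?A" for i
    using that z assms by (cases "i = 0") (auto simp: signed_perms_def)
  then have "bij_betw w (- ?A) (- ?A) = bij_betw id (- ?A) (- ?A)" by (intro bij_betw_cong) (metis ComplD id_apply)
  then have "bij_betw w (- ?A) (- ?A)" by simp
  then have "bij_betw w (?A \<union> - ?A) (?A \<union> - ?A)"
    using assms by (intro bij_betw_combine) (auto simp: signed_perms_def)
  then show ?thesis unfolding Compl_partition .
qed

lemma inv_signed_perms:
  assumes "w \<in> signed_perms n"
  shows "inv w \<in> signed_perms n"
proof -
  have b: "bij w" using signed_perms_bij assms .
  let ?A = "{-int n..int n} - {0}"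
  have "w ` ?A = ?A" "inj_on w UNIV"
    using assms b by (auto simp: signed_perms_def bij_betw_def bij_def)
  then have "bij_betw (inv w) ?A ?A"
    by (metis (no_types, lifting) b bij_betw_imageI bij_betw_def bij_imp_bij_inv inj_imp_surj_inv
        image_inv_f_f inj_on_subset subset_UNIV)
  moreover have "inv w (- i) = - inv w i" for i
    using assms b by (intro inv_f_eq) (auto simp: signed_perms_def bij_is_inj bij_is_surj surj_f_inv_f)
  moreover have "inv w i = i" if "\<bar>i\<bar> > int n" for i
    using assms b that by (intro inv_f_eq) (auto simp: signed_perms_def bij_is_inj)
  ultimately show ?thesis by (simp add: signed_perms_def)
qed

lemma signed_perms_abs:
  assumes "v \<in> signed_perms n" "1 \<le> i" "i \<le> int n"
  shows "1 \<le> \<bar>v i\<bar>" "\<bar>v i\<bar> \<le> int n"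
proof -
  have "v i \<in> {-int n..int n} - {0}"
    using assms unfolding signed_perms_def bij_betw_def by fastforce
  then show "1 \<le> \<bar>v i\<bar>" "\<bar>v i\<bar> \<le> int n" by auto
qed

lemma window_inv_signed_lists:
  assumes "w \<in> signed_perms n"
  shows "window_inv n w \<in> signed_lists n"
proof -
  have v: "inv w \<in> signed_perms n" using inv_signed_perms assms .
  have "k \<in> abs ` inv w ` {1..int n}" if k: "k \<in> {1..int n}" for k
  proof -
    \<comment> \<open>The preimage used is the absolute value of \<open>w k\<close>; by oddness its
      image is \<open>k\<close> up to sign.\<close>
    have "inv w (w k) = k" using signed_perms_bij[OF assms] by (simp add: bij_is_inj)
    moreover have "inv w (- w k) = - inv w (w k)" using v by (simp add: signed_perms_def)
    ultimately have "\<bar>inv w \<bar>w k\<bar>\<bar> = k" using k by (cases "w k \<ge> 0") auto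
    then show ?thesis using signed_perms_abs[OF assms, of k] k by (metis atLeastAtMost_iff image_eqI)
  qed
  then have "abs ` inv w ` {1..int n} = {1..int n}"
    using signed_perms_abs[OF v] by auto
  then show ?thesis by (simp add: signed_lists_def window_inv_def)
qed

lemma window_inv_nth: "k < n \<Longrightarrow> window_inv n w ! k = inv w (int k + 1)"
  by (simp add: window_inv_def add.commute)

lemma length_window_inv [simp]: "length (window_inv n w) = n"
  by (simp add: window_inv_def)

lemma inj_on_window_inv: "inj_on (window_inv n) (signed_perms n)"
proof (rule inj_onI)
  fix w u assume w: "w \<in> signed_perms n" and u: "u \<in> signed_perms n"
    and e: "window_inv n w = window_inv n u"
  note iw = inv_signed_perms[OF w] and iu = inv_signed_perms[OF u]
  have pos: "inv w i = inv u i" if "i > 0" for i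
  proof (cases "i \<le> int n")
    case True then show ?thesis using e that by (simp add: window_inv_def)
  next
    case False then show ?thesis using iw iu by (simp add: signed_perms_def)
  qed
  have "inv w i = inv u i" for i
  proof -
    consider "i > 0" | "i = 0" | "- i > 0" by linarith
    then show ?thesis
    proof cases
      case 2 then show ?thesis using iw iu odd_zero[of "inv w"] odd_zero[of "inv u"] by (simp add: signed_perms_def)
    next
      case 3
      then have "inv w (- i) = inv u (- i)" by (rule pos)
      then show ?thesis using iw iu by (simp add: signed_perms_def)
    qed (rule pos)
  qed
  then have "inv w = inv u" by blast
  then show "w = u" using signed_perms_bij w u by (metis inv_inv_eq)
qed

section \<open>Transfer of words and full commutativity to lists\<close>

lemma cox_gen_cox_gen [simp]: "cox_gen a (cox_gen a i) = i"
  by (auto simp: cox_gen_def)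

lemma cox_gen_signed_perms:
  assumes "a < n"
  shows "cox_gen a \<in> signed_perms n"
proof -
  have "bij_betw (cox_gen a) ({-int n..int n} - {0}) ({-int n..int n} - {0})"
    using assms by (intro bij_betw_byWitness[where f' = "cox_gen a"]) (auto simp: cox_gen_def)
  then show ?thesis using assms by (auto simp: signed_perms_def cox_gen_def)
qed

lemma comp_signed_perms:
  "u \<in> signed_perms n \<Longrightarrow> v \<in> signed_perms n \<Longrightarrow> u \<circ> v \<in> signed_perms n"
  by (auto simp: signed_perms_def intro: bij_betw_trans)

lemma id_signed_perms: "id \<in> signed_perms n"
  by (simp add: signed_perms_def)

lemma window_inv_cox_gen:
  assumes "w \<in> signed_perms n" "a < n"
  shows "window_inv n (cox_gen a \<circ> w) = act a (window_inv n w)"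
proof -
  have "bij (cox_gen a)" using cox_gen_signed_perms assms(2) signed_perms_bij by blast
  then have e: "inv (cox_gen a \<circ> w) = inv w \<circ> cox_gen a"
    using signed_perms_bij[OF assms(1)]
    by (metis cox_gen_cox_gen inv_equality o_inv_distrib)
  have odd: "inv w (- i) = - inv w i" for i
    using inv_signed_perms[OF assms(1)] by (simp add: signed_perms_def)
  have s: "inv w (- 1) = - inv w 1" by (rule odd)
  show ?thesis
  proof (cases a)
    case 0
    have "[1..int n] = 1 # [2..int n]" using assms(2) by (simp add: upto_rec1)
    then show ?thesis using 0 e s by (simp add: window_inv_def cox_gen_def)
  next
    case (Suc k)
    show ?thesis
    proof (rule nth_equalityI)
      fix i assume "i < length (window_inv n (cox_gen a \<circ> w))"
      then show "window_inv n (cox_gen a \<circ> w) ! i = act a (window_inv n w) ! i"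
        using Suc assms(2) e
        by (auto simp: window_inv_nth act_def nth_list_update cox_gen_def add.commute)
    qed simp
  qed
qed

lemma word_prod_simps [simp]:
  "word_prod [] = id" "word_prod (a # ws) = cox_gen a \<circ> word_prod ws"
  by (simp_all add: word_prod_def)

lemma word_prod_signed_perms: "ws \<in> gen_words n \<Longrightarrow> word_prod ws \<in> signed_perms n"
  by (induction ws) (auto simp: id_signed_perms intro: comp_signed_perms cox_gen_signed_perms
      simp del: comp_apply)

lemma window_inv_word_prod: "ws \<in> gen_words n \<Longrightarrow> window_inv n (word_prod ws) = eval_word n ws"
proof (induction ws)
  case Nil
  have "inv id = (id :: int \<Rightarrow> int)" by simp
  then show ?case by (simp add: window_inv_def)
next
  case (Cons a ws)
  then show ?case using window_inv_cox_gen[of "word_prod ws" n a] word_prod_signed_perms[of ws n]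
    by (metis gen_words_Cons word_prod_simps(2) eval_word_simps(2))
qed

text \<open>\<open>ell\<close> is a lower bound for word lengths and is attained, so it equals the
  minimum in \<open>reduced_word\<close>; injectivity of the window turns equality of lists into
  equality of maps.\<close>

lemma reduced_word_iff:
  assumes "w \<in> signed_perms n"
  shows "reduced_word n w ws \<longleftrightarrow> ws \<in> red n (window_inv n w)"
proof -
  have e: "word_prod vs = w \<longleftrightarrow> eval_word n vs = window_inv n w" if "vs \<in> gen_words n" for vs
    using inj_onD[OF inj_on_window_inv] word_prod_signed_perms[OF that] assms window_inv_word_prod[OF that]
    by metis
  obtain us where "us \<in> red n (window_inv n w)"
    using red_exists[OF window_inv_signed_lists[OF assms]] by blast
  then have us: "us \<in> gen_words n" "word_prod us = w" "length us = ell (window_inv n w)"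
    using e by (auto simp: red_def)
  have le: "ell (window_inv n w) \<le> length vs" if "vs \<in> gen_words n" "word_prod vs = w" for vs
    using ell_eval_word_le[OF that(1)] e[OF that(1)] that(2) by simp
  show ?thesis
    unfolding reduced_word_def red_def using us le e by fastforce
qed

lemma window_inv_FC: "bij_betw (window_inv n) (FC n) {xs. good n xs}"
proof -
  have fc: "w \<in> FC n \<longleftrightarrow> good n (window_inv n w)" if "w \<in> signed_perms n" for w
    using that fc_iff_good[OF window_inv_signed_lists[OF that]]
    by (auto simp: FC_def fully_commutative_def reduced_word_iff fc_def)
  have "xs \<in> window_inv n ` FC n" if "good n xs" for xs
  proof -
    \<comment> \<open>The preimage of a good list is the product of a reduced word for it.\<close>
    obtain ws where ws: "ws \<in> gen_words n" "eval_word n ws = xs"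
      using red_exists[OF good_signed] \<open>good n xs\<close> by (auto simp: red_def)
    then show ?thesis
      using fc[OF word_prod_signed_perms[OF ws(1)]] window_inv_word_prod[OF ws(1)] that by force
  qed
  moreover have "window_inv n ` FC n \<subseteq> {xs. good n xs}" using fc by (auto simp: FC_def)
  moreover have "inj_on (window_inv n) (FC n)"
    by (rule inj_on_subset[OF inj_on_window_inv]) (auto simp: FC_def)
  ultimately show ?thesis by (auto simp: bij_betw_def)
qed


section \<open>Statistics on the generating tree\<close>

text \<open>The positions \<open>0\<close> and \<open>n\<close> always count as cuts, hence the \<open>- 1\<close> in \<open>blocks\<close>.\<close>

definition cuts :: "int list \<Rightarrow> nat set" where
  "cuts xs = {i. i \<le> length xs \<and> (\<forall>x\<in>set (take i xs). \<forall>y\<in>set (drop i xs). x < y)}"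

definition blocks :: "int list \<Rightarrow> nat" where
  "blocks xs = card (cuts xs) - 1"

fun run :: "int list \<Rightarrow> nat" where
  "run [] = 0"
| "run (y # ys) = (if sorted (y # ys) then Suc (length ys) else run ys)"

text \<open>The last \<open>m\<close> blocks are singletons iff the last \<open>m + 1\<close>
  positions, the end included, are all cuts.\<close>

definition trail :: "int list \<Rightarrow> nat" where
  "trail xs = length xs - (LEAST i. {i..length xs} \<subseteq> cuts xs)"

lemma run_sorted: "sorted xs \<Longrightarrow> run xs = length xs"
  by (cases xs) auto

lemma run_le: "run xs \<le> length xs"
  by (induction xs) auto

lemma le_run_iff: "j \<le> length xs \<Longrightarrow> j \<le> run xs \<longleftrightarrow> sorted (drop (length xs - j) xs)"
proof (induction xs)
  case (Cons y ys)
  show ?case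
  proof (cases "j \<le> length ys")
    case True
    have "sorted (drop (length ys - j) ys)" if "sorted (y # ys)"
      using that by (auto simp: sorted_wrt_drop)
    then show ?thesis using Cons True by (auto simp: Suc_diff_le)
  next
    case False
    then have "j = Suc (length ys)" using Cons.prems by simp
    then show ?thesis using run_le[of ys] by auto
  qed
qed simp

lemma run_eqI:
  assumes "j \<le> length xs" "sorted (drop (length xs - j) xs)"
    "j < length xs \<Longrightarrow> \<not> sorted (drop (length xs - Suc j) xs)"
  shows "run xs = j"
  using le_run_iff[of j xs] le_run_iff[of "Suc j" xs] assms run_le[of xs] by (cases "j < length xs") auto

lemma run_snoc: "(\<And>y. y \<in> set ys \<Longrightarrow> y < m) \<Longrightarrow> run (ys @ [m]) = Suc (run ys)"
  by (induction ys) (auto simp: sorted_append less_imp_le)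

lemma run_insert:
  assumes "z < m" "sorted (z # zs)"
  shows "run (ys @ m # z # zs) = Suc (length zs)"
  using assms by (induction ys) (auto simp: sorted_append)

lemma cuts_0 [simp]: "0 \<in> cuts xs" and cuts_length [simp]: "length xs \<in> cuts xs"
  by (auto simp: cuts_def)

lemma cuts_bound: "i \<in> cuts xs \<Longrightarrow> i \<le> length xs"
  by (simp add: cuts_def)

lemma finite_cuts [simp]: "finite (cuts xs)"
  by (simp add: cuts_def)

lemma le_trail_iff: "j \<le> length xs \<Longrightarrow> j \<le> trail xs \<longleftrightarrow> {length xs - j..length xs} \<subseteq> cuts xs"
proof -
  assume j: "j \<le> length xs"
  let ?P = "\<lambda>i. {i..length xs} \<subseteq> cuts xs"
  let ?l = "LEAST i. ?P i"
  have P: "?P (length xs)" by simp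
  then have l: "?P ?l" by (rule LeastI)
  have le: "?l \<le> length xs" using P by (rule Least_le)
  have "?l \<le> length xs - j \<longleftrightarrow> ?P (length xs - j)"
  proof
    assume "?l \<le> length xs - j"
    then show "?P (length xs - j)" using l atLeastatMost_subset_iff by (meson order_refl order_trans)
  next
    assume "?P (length xs - j)"
    then show "?l \<le> length xs - j" by (rule Least_le)
  qed
  moreover have "j \<le> trail xs \<longleftrightarrow> ?l \<le> length xs - j" using j le unfolding trail_def by linarith
  ultimately show ?thesis by blast
qed

lemma trail_le: "trail xs \<le> length xs"
  by (simp add: trail_def)

lemma cuts_snoc:
  assumes "\<And>y. y \<in> set ys \<Longrightarrow> y < m"
  shows "cuts (ys @ [m]) = insert (Suc (length ys)) (cuts ys)"
proof -
  have "i \<in> cuts (ys @ [m]) \<longleftrightarrow> i \<in> cuts ys" if "i \<le> length ys" for i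
    using that assms by (auto simp: cuts_def dest: in_set_takeD)
  moreover have "Suc (length ys) \<in> cuts (ys @ [m])" using cuts_length[of "ys @ [m]"] by simp
  moreover have "i = Suc (length ys)" if "i \<in> cuts (ys @ [m])" "\<not> i \<le> length ys" for i
    using cuts_bound[OF that(1)] that(2) by simp
  ultimately show ?thesis using cuts_bound[of _ ys] by blast
qed

lemma blocks_snoc:
  assumes "\<And>y. y \<in> set ys \<Longrightarrow> y < m"
  shows "blocks (ys @ [m]) = Suc (blocks ys)"
proof -
  have "Suc (length ys) \<notin> cuts ys" using cuts_bound by fastforce
  moreover have "card (cuts ys) > 0" using cuts_0[of ys] by (auto simp: card_gt_0_iff simp del: cuts_0)
  ultimately show ?thesis by (simp add: blocks_def cuts_snoc[OF assms])
qed

lemma trail_snoc: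
  assumes "\<And>y. y \<in> set ys \<Longrightarrow> y < m"
  shows "trail (ys @ [m]) = Suc (trail ys)"
proof -
  have "{i..length (ys @ [m])} \<subseteq> cuts (ys @ [m]) \<longleftrightarrow> {i..length ys} \<subseteq> cuts ys" for i
    using cuts_snoc[OF assms] by (auto simp: subset_iff le_Suc_eq)
  moreover have "(LEAST i. {i..length ys} \<subseteq> cuts ys) \<le> length ys" by (intro Least_le) simp
  ultimately show ?thesis by (simp add: trail_def Suc_diff_le)
qed

text \<open>Cuts in front of the new maximum survive. Behind it every position is spoiled by a
  smaller entry still to come, except the end, which is now one place further.\<close>

lemma cuts_insert:
  assumes "\<And>y. y \<in> set (ys @ zs) \<Longrightarrow> y < m" "zs \<noteq> []"
  shows "cuts (ys @ m # zs) = insert (Suc (length (ys @ zs))) {i \<in> cuts (ys @ zs). i \<le> length ys}"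
proof -
  have 1: "i \<in> cuts (ys @ m # zs) \<longleftrightarrow> i \<in> cuts (ys @ zs)" if "i \<le> length ys" for i
    using that assms by (auto simp: cuts_def dest: in_set_takeD)
  have 2: "i = Suc (length (ys @ zs))" if i: "i \<in> cuts (ys @ m # zs)" "length ys < i" for i
  proof (rule ccontr)
    assume n: "i \<noteq> Suc (length (ys @ zs))"
    obtain k where k: "i = length ys + Suc k" using i(2) less_imp_Suc_add by (metis add_Suc_right)
    then have "k < length zs" using i(1) n by (auto simp: cuts_def)
    then have "zs ! k \<in> set (drop k zs)" by (metis Cons_nth_drop_Suc list.set_intros(1))
    then have "m < zs ! k" using i(1) k by (auto simp: cuts_def)
    moreover have "zs ! k < m" using assms \<open>k < length zs\<close> by simp
    ultimately show False by simp
  qed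
  have 3: "Suc (length (ys @ zs)) \<in> cuts (ys @ m # zs)" using cuts_length[of "ys @ m # zs"] by simp
  show ?thesis
  proof (rule set_eqI)
    fix i
    show "i \<in> cuts (ys @ m # zs)
      \<longleftrightarrow> i \<in> insert (Suc (length (ys @ zs))) {i \<in> cuts (ys @ zs). i \<le> length ys}"
    proof (cases "i \<le> length ys")
      case True
      then show ?thesis using 1 by auto
    next
      case False
      then show ?thesis using 2[of i] 3 by fastforce
    qed
  qed
qed

lemma trail_insert:
  assumes "\<And>y. y \<in> set (ys @ zs) \<Longrightarrow> y < m" "zs \<noteq> []"
  shows "trail (ys @ m # zs) = 0"
proof -
  \<comment> \<open>The position just before the last entry is not a cut, since the larger
    \<open>m\<close> stands before it.\<close>
  have "length (ys @ zs) \<notin> cuts (ys @ m # zs)"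
    using cuts_insert[OF assms] assms(2) by auto
  then have "\<not> 1 \<le> trail (ys @ m # zs)" by (subst le_trail_iff) (auto simp: subset_iff)
  then show ?thesis by simp
qed

text \<open>Moving a cut to the right inside a strictly increasing suffix only transfers entries
  that are already smaller than everything after them.\<close>

lemma cuts_mono:
  assumes "sorted_wrt (<) zs" "i \<in> cuts (ys @ zs)" "length ys \<le> i" "i \<le> k" "k \<le> length (ys @ zs)"
  shows "k \<in> cuts (ys @ zs)"
proof -
  obtain a b where ab: "i = length ys + a" "k = length ys + a + b"
    using assms(3,4) by (metis le_iff_add)
  have zs: "zs = take a zs @ take b (drop a zs) @ drop (b + a) zs"
    by (metis append_take_drop_id drop_drop)
  have "\<forall>x\<in>set (take b (drop a zs)). \<forall>y\<in>set (drop (b + a) zs). x < y"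
  proof -
    have "sorted_wrt (<) (take a zs @ take b (drop a zs) @ drop (b + a) zs)"
      using assms(1) unfolding zs[symmetric] .
    then show ?thesis by (simp only: sorted_wrt_append) blast
  qed
  moreover have "take (a + b) zs = take a zs @ take b (drop a zs)" by (simp add: take_add)
  moreover have "set (drop (a + b) zs) \<subseteq> set (drop a zs)" by (metis add.commute drop_drop set_drop_subset)
  ultimately show ?thesis using assms(2,5) ab by (auto simp: cuts_def add.commute)
qed

text \<open>By \<open>cuts_mono\<close> the cuts behind \<open>ys\<close> form an interval up to the
  end. It has \<open>?d + 1\<close> elements, bounded both by the trailing singletons and by the
  room \<open>length zs\<close>; insertion merges them into the single cut at the end.\<close>

lemma blocks_insert:
  assumes "\<And>y. y \<in> set (ys @ zs) \<Longrightarrow> y < m" "zs \<noteq> []" "sorted_wrt (<) zs"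
  shows "blocks (ys @ m # zs) = blocks (ys @ zs) - min (length zs - 1) (trail (ys @ zs))"
proof -
  let ?xs = "ys @ zs" and ?d = "min (length zs - 1) (trail (ys @ zs))"
  have d: "?d \<le> length ?xs" by auto
  have "{i \<in> cuts ?xs. length ys < i} = {length ?xs - ?d..length ?xs}"
  proof
    show "{length ?xs - ?d..length ?xs} \<subseteq> {i \<in> cuts ?xs. length ys < i}"
    proof -
      have "{length ?xs - ?d..length ?xs} \<subseteq> cuts ?xs"
        using le_trail_iff[OF d] by simp
      moreover have "length ys < length ?xs - ?d" using assms(2) by (cases zs) auto
      ultimately show ?thesis by auto
    qed
    show "{i \<in> cuts ?xs. length ys < i} \<subseteq> {length ?xs - ?d..length ?xs}"
    proof
      fix i assume "i \<in> {i \<in> cuts ?xs. length ys < i}"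
      then have i: "i \<in> cuts ?xs" "length ys < i" "i \<le> length ?xs" using cuts_bound[of i ?xs] by auto
      have "{i..length ?xs} \<subseteq> cuts ?xs" using cuts_mono[OF assms(3) i(1)] i by auto
      then have "length ?xs - i \<le> trail ?xs" using i by (subst le_trail_iff) auto
      then show "i \<in> {length ?xs - ?d..length ?xs}" using i by auto
    qed
  qed
  then have "card {i \<in> cuts ?xs. length ys < i} = Suc ?d" using d by (simp add: Suc_diff_le)
  moreover have "cuts ?xs = {i \<in> cuts ?xs. i \<le> length ys} \<union> {i \<in> cuts ?xs. length ys < i}" by auto
  then have "card (cuts ?xs) = card {i \<in> cuts ?xs. i \<le> length ys} + card {i \<in> cuts ?xs. length ys < i}"
    by (metis (no_types, lifting) card_Un_disjoint disjoint_iff finite_Un finite_cuts mem_Collect_eq not_le)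
  moreover have "Suc (length ?xs) \<notin> {i \<in> cuts ?xs. i \<le> length ys}" by auto
  then have "card (cuts (ys @ m # zs)) = Suc (card {i \<in> cuts ?xs. i \<le> length ys})"
    using cuts_insert[OF assms(1,2)] by simp
  ultimately show ?thesis by (simp add: blocks_def)
qed

lemma stats_sorted:
  assumes "sorted_wrt (<) xs"
  shows "blocks xs = length xs" "run xs = length xs" "trail xs = length xs"
proof -
  have "cuts xs = {0..length xs}"
    using cuts_mono[of xs 0 "[]"] assms by (auto dest: cuts_bound)
  then show "blocks xs = length xs" "trail xs = length xs" by (simp_all add: blocks_def trail_def)
  show "run xs = length xs" using assms by (intro run_sorted strict_sorted_imp_sorted)
qed

text \<open>The nonempty \<open>ys\<close> together with the minimum \<open>m\<close> forms the
  first block, and the entries of \<open>zs\<close> are singleton blocks. Here b and l agree and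
  exceed the trail by one.\<close>

lemma stats_neg_inner:
  assumes "sorted_wrt (<) (ys @ zs)" "ys \<noteq> []" "\<And>y. y \<in> set (ys @ zs) \<Longrightarrow> m < y"
  shows "blocks (ys @ m # zs) = Suc (length zs)" "run (ys @ m # zs) = Suc (length zs)"
    "trail (ys @ m # zs) = length zs"
proof -
  let ?xs = "ys @ m # zs"
  have s: "sorted_wrt (<) zs" "\<And>x y. x \<in> set ys \<Longrightarrow> y \<in> set zs \<Longrightarrow> x < y"
    using assms(1) by (auto simp: sorted_wrt_append)
  have 1: "i \<notin> cuts ?xs" if "0 < i" "i \<le> length ys" for i
  proof
    assume i: "i \<in> cuts ?xs"
    obtain y ys' where "ys = y # ys'" using assms(2) by (cases ys) auto
    then have "y \<in> set (take i ?xs)" "m \<in> set (drop i ?xs)" using that by (cases i; simp)+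
    then have "y < m" using i by (auto simp: cuts_def)
    then show False using assms(3)[of y] \<open>ys = y # ys'\<close> by simp
  qed
  have "Suc (length ys) \<in> cuts ((ys @ [m]) @ zs)"
    using s(2) assms(3) by (auto simp: cuts_def)
  then have 2: "i \<in> cuts ?xs" if "length ys < i" "i \<le> length ?xs" for i
    using cuts_mono[OF s(1), of "Suc (length ys)" "ys @ [m]" i] that by auto
  have c: "cuts ?xs = insert 0 {Suc (length ys)..length ?xs}"
    using 1 2 cuts_bound[of _ ?xs] by (force simp: not_less)
  then show "blocks ?xs = Suc (length zs)" by (simp add: blocks_def)
  have "length zs \<le> trail ?xs" using 2 by (subst le_trail_iff) auto
  moreover have "\<not> Suc (length zs) \<le> trail ?xs"
    using 1[of "length ys"] assms(2) by (subst le_trail_iff) (auto simp: subset_iff)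
  ultimately show "trail ?xs = length zs" by simp
  have "last ys > m" using assms(2,3) by simp
  then have "\<not> sorted (last ys # m # zs)" by simp
  moreover have "drop (length ?xs - Suc (Suc (length zs))) ?xs = last ys # m # zs"
    using assms(2) by (cases ys rule: rev_cases) auto
  moreover have "sorted (m # zs)" using s(1) assms(3) by (auto intro: less_imp_le strict_sorted_imp_sorted)
  ultimately show "run ?xs = Suc (length zs)" using assms(2) by (intro run_eqI) (auto simp: Suc_le_eq)
qed

section \<open>Signed positions, and the effect of insertion on descents and negative values\<close>

definition index :: "int list \<Rightarrow> int \<Rightarrow> nat" where
  "index xs y = length (takeWhile (\<lambda>u. u \<noteq> y) xs)"

lemma index_append: "index (ys @ zs) y = (if y \<in> set ys then index ys y else length ys + index zs y)"
  by (induction ys) (auto simp: index_def)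

lemma index_Cons: "index (y # ys) u = (if u = y then 0 else Suc (index ys u))"
  by (simp add: index_def)

lemma index_less: "y \<in> set ys \<Longrightarrow> index ys y < length ys"
  by (induction ys) (auto simp: index_Cons)

lemma index_nth: "distinct xs \<Longrightarrow> j < length xs \<Longrightarrow> index xs (xs ! j) = j"
  by (induction xs arbitrary: j) (auto simp: index_Cons nth_Cons split: nat.splits)

text \<open>\<open>spos\<close> recovers \<open>w\<close> from the list of values of \<open>inv w\<close>.\<close>

definition spos :: "int list \<Rightarrow> int \<Rightarrow> int" where
  "spos xs k = (if k = 0 then 0 else if k \<in> set xs then int (index xs k) + 1 else - int (index xs (- k)) - 1)"

definition ldesc :: "int list \<Rightarrow> nat set" where
  "ldesc xs = {i. i < length xs \<and> spos xs (int i) > spos xs (int i + 1)}"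

definition nvals :: "int list \<Rightarrow> nat set" where
  "nvals xs = {i. 1 \<le> i \<and> i \<le> length xs \<and> - int i \<in> set xs}"

definition key :: "int list \<Rightarrow> nat set \<times> nat set" where
  "key xs = (ldesc xs, nvals xs)"

text \<open>Insertion behind \<open>ys\<close> changes every signed position by the strictly
  increasing map \<open>?f\<close>, so comparisons of old values are kept.\<close>

lemma spos_insert_less_iff:
  assumes "ys @ zs \<in> signed_lists n" "\<bar>k\<bar> \<le> int n" "\<bar>l\<bar> \<le> int n"
  shows "spos (ys @ (int n + 1) # zs) k < spos (ys @ (int n + 1) # zs) l
    \<longleftrightarrow> spos (ys @ zs) k < spos (ys @ zs) l"
proof -
  let ?f = "\<lambda>p. if p > int (length ys) then p + 1 else if p < - int (length ys) then p - 1 else p"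
  have f: "spos (ys @ (int n + 1) # zs) k = ?f (spos (ys @ zs) k)" if "\<bar>k\<bar> \<le> int n" for k
  proof (cases "k = 0")
    case True then show ?thesis by (simp add: spos_def)
  next
    case False
    then show ?thesis using that index_less[of k ys] index_less[of "- k" ys]
      by (auto simp: spos_def index_append index_Cons)
  qed
  show ?thesis unfolding f[OF assms(2)] f[OF assms(3)] by auto
qed

lemma key_insert_aux:
  assumes "ys @ zs \<in> signed_lists n"
  shows "nvals (ys @ (int n + 1) # zs) = nvals (ys @ zs)"
    "ldesc (ys @ (int n + 1) # zs) = ldesc (ys @ zs) \<union> (if int n \<in> set zs then {n} else {})"
proof -
  let ?ws = "ys @ (int n + 1) # zs" and ?xs = "ys @ zs"
  have len: "length ?xs = n" using assms by (simp add: signed_lists_def)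
  have b: "\<bar>y\<bar> \<le> int n" if "y \<in> set ?xs" for y using signed_lists_bound[OF assms that] .
  have "- int i \<in> set ?ws \<longleftrightarrow> - int i \<in> set ?xs" for i by auto
  moreover have "i \<le> n" if "- int i \<in> set ?xs" for i using b[OF that] by simp
  ultimately show "nvals ?ws = nvals ?xs"
    using len by (auto simp: nvals_def le_Suc_eq)
  have i: "i \<in> ldesc ?ws \<longleftrightarrow> i \<in> ldesc ?xs" if "i < n" for i
    using that len spos_insert_less_iff[OF assms, of "int i + 1" "int i"] by (simp add: ldesc_def)
  have N: "spos ?ws (int n + 1) = int (length ys) + 1"
    using b[of "int n + 1"] by (auto simp: spos_def index_append index_Cons)
  have n: "n \<in> ldesc ?ws \<longleftrightarrow> int n \<in> set zs"
  proof -
    \<comment> \<open>Only \<open>n\<close> against \<open>n + 1\<close> is a new comparison. If the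
      value \<open>n\<close> does not occur, its signed position is at most 0, so there is no
      descent.\<close>
    have "spos ?ws (int n) > int (length ys) + 1 \<longleftrightarrow> int n \<in> set zs"
    proof (cases "int n \<in> set ?xs")
      case True
      then have "n \<noteq> 0" using signed_lists_nonzero[OF assms] by force
      moreover have "int n \<notin> set ys \<or> int n \<notin> set zs" using signed_lists_distinct'[OF assms] by auto
      ultimately show ?thesis using True index_less[of "int n" ys]
        by (auto simp: spos_def index_append index_Cons)
    next
      case False
      then show ?thesis by (auto simp: spos_def)
    qed
    then show ?thesis using N len by (simp add: ldesc_def)
  qed
  show "ldesc ?ws = ldesc ?xs \<union> (if int n \<in> set zs then {n} else {})"
  proof (rule set_eqI)
    fix j
    have "j \<notin> ldesc ?ws" if "n < j" using that len by (simp add: ldesc_def)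
    moreover have "j \<notin> ldesc ?xs" if "n \<le> j" using that len by (simp add: ldesc_def)
    ultimately show "j \<in> ldesc ?ws \<longleftrightarrow> j \<in> ldesc ?xs \<union> (if int n \<in> set zs then {n} else {})"
      using i[of j] n by (cases "j < n"; cases "j = n") auto
  qed
qed

text \<open>The value \<open>n\<close> can lie in an increasing suffix only as its last entry. A
  positive trail says that the last entry is the maximum, and this is \<open>n\<close> unless
  \<open>- n\<close> occurs. Thus the new descent does not depend on the length of the
  suffix.\<close>

lemma max_in_sorted_suffix_iff:
  assumes "ys @ zs \<in> signed_lists n" "sorted zs" "zs \<noteq> []"
  shows "int n \<in> set zs \<longleftrightarrow> 1 \<le> trail (ys @ zs) \<and> n \<notin> nvals (ys @ zs)"
proof -
  obtain as c where zs: "zs = as @ [c]" using assms(3) by (cases zs rule: rev_cases) auto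
  let ?xs = "ys @ zs"
  have len: "length ?xs = n" "n \<ge> 1" using assms(1,3) by (auto simp: signed_lists_def Suc_le_eq)
  have d: "distinct ?xs" "distinct (map abs ?xs)" using signed_lists_distinct'[OF assms(1)] signed_lists_distinct[OF assms(1)] by auto
  have "{n - 1..n} = {n - 1, n}" using len by auto
  moreover have "n \<in> cuts ?xs" using cuts_length[of ?xs] unfolding len .
  moreover have "1 \<le> trail ?xs \<longleftrightarrow> {n - 1..n} \<subseteq> cuts ?xs"
    using le_trail_iff[of 1 ?xs] len(2) unfolding len(1) .
  ultimately have "1 \<le> trail ?xs \<longleftrightarrow> n - 1 \<in> cuts ?xs"
    by (simp only: insert_subset empty_subsetI simp_thms)
  also have "\<dots> \<longleftrightarrow> length (ys @ as) \<in> cuts ((ys @ as) @ [c])"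
    using len zs by auto
  also have "\<dots> \<longleftrightarrow> (\<forall>y\<in>set (ys @ as). y < c)"
    by (simp add: cuts_def)
  finally have t: "1 \<le> trail ?xs \<longleftrightarrow> (\<forall>y\<in>set (ys @ as). y < c)" .
  have nv: "n \<in> nvals ?xs \<longleftrightarrow> - int n \<in> set ?xs" using len by (simp add: nvals_def)
  have "int n \<in> abs ` set ?xs" using assms(1) len(2) by (simp add: signed_lists_def)
  then obtain y where "y \<in> set ?xs" "int n = \<bar>y\<bar>" by blast
  moreover from this have "y = int n \<or> y = - int n" by linarith
  ultimately have or: "int n \<in> set ?xs \<or> - int n \<in> set ?xs" by blast
  have nand: "\<not> (int n \<in> set ?xs \<and> - int n \<in> set ?xs)"
  proof
    assume a: "int n \<in> set ?xs \<and> - int n \<in> set ?xs"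
    have "inj_on abs (set ?xs)" using d(2) by (simp only: distinct_map)
    from inj_onD[OF this _ conjunct1[OF a] conjunct2[OF a]] show False using len by simp
  qed
  have b: "y \<le> int n" if "y \<in> set ?xs" for y using signed_lists_bound[OF assms(1) that] by simp
  show ?thesis
  proof
    assume n: "int n \<in> set zs"
    have "int n \<le> c" using n assms(2) zs by (auto simp: sorted_append)
    then have c: "c = int n" using b[of c] zs by simp
    have "y < c" if "y \<in> set (ys @ as)" for y
      using b[of y] c that d(1) zs by (cases "y = c") auto
    moreover have "int n \<in> set ?xs" using n by simp
    ultimately show "1 \<le> trail ?xs \<and> n \<notin> nvals ?xs" using t nv nand by blast
  next
    assume "1 \<le> trail ?xs \<and> n \<notin> nvals ?xs"
    then have "int n \<in> set ?xs" and m: "\<forall>y\<in>set (ys @ as). y < c" using t nv or by blast+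
    moreover have "c \<le> int n" using b[of c] zs by simp
    then have "int n \<notin> set (ys @ as)" using m by fastforce
    ultimately show "int n \<in> set zs" using zs by simp
  qed
qed

lemma key_snoc:
  assumes "ys \<in> signed_lists n"
  shows "key (ys @ [int n + 1]) = key ys"
  using key_insert_aux[of ys "[]" n] assms by (simp add: key_def)

text \<open>The insertion depth does not enter, so all insertions into one list carry the same
  weight.\<close>

definition key_step :: "nat \<Rightarrow> nat \<Rightarrow> nat set \<times> nat set \<Rightarrow> nat set \<times> nat set" where
  "key_step n m k = (fst k \<union> (if 1 \<le> m \<and> n \<notin> snd k then {n} else {}), snd k)"

lemma key_insert:
  assumes "ys @ zs \<in> signed_lists n" "sorted zs" "zs \<noteq> []"
  shows "key (ys @ (int n + 1) # zs) = key_step n (trail (ys @ zs)) (key (ys @ zs))"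
  using key_insert_aux[OF assms(1)] max_in_sorted_suffix_iff[OF assms] by (simp add: key_def key_step_def)


section \<open>The statistics of \<open>w\<close> read off the list\<close>

lemma spos_window_inv:
  assumes "w \<in> signed_perms n" "1 \<le> k" "k \<le> int n"
  shows "spos (window_inv n w) k = w k"
proof -
  let ?xs = "window_inv n w"
  have sl: "?xs \<in> signed_lists n" using window_inv_signed_lists assms(1) .
  have p: "1 \<le> \<bar>w k\<bar>" "\<bar>w k\<bar> \<le> int n" using signed_perms_abs assms by blast+
  \<comment> \<open>This is the 0-based position at which \<open>k\<close> or \<open>- k\<close>
    stands.\<close>
  define j where "j = nat \<bar>w k\<bar> - 1"
  have j: "j < n" "int j + 1 = \<bar>w k\<bar>" using p by (auto simp: j_def)
  have ix: "index ?xs (?xs ! j) = j"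
    using j by (simp add: index_nth signed_lists_distinct'[OF sl])
  have mem: "?xs ! j \<in> set ?xs" using j by simp
  have inv: "inv w (w k) = k" using signed_perms_bij[OF assms(1)] by (simp add: bij_is_inj)
  have odd: "inv w (- w k) = - inv w (w k)"
    using inv_signed_perms[OF assms(1)] by (simp add: signed_perms_def)
  show ?thesis
  proof (cases "w k > 0")
    case True
    then have "?xs ! j = k" using j inv by (simp add: window_inv_nth)
    then show ?thesis using ix mem True j assms(2) by (simp add: spos_def)
  next
    case False
    then have x: "?xs ! j = - k" using j inv odd by (simp add: window_inv_nth)
    have "k \<notin> set ?xs"
    proof
      assume k: "k \<in> set ?xs"
      have "inj_on abs (set ?xs)" using signed_lists_distinct[OF sl] by (simp only: distinct_map)
      from inj_onD[OF this _ k mem] show False using x assms(2) by simp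
    qed
    then show ?thesis using ix x False j assms(2) by (simp add: spos_def)
  qed
qed

lemma DesB_window_inv:
  assumes "w \<in> signed_perms n" "n \<ge> 1"
  shows "DesB n w = ldesc (window_inv n w)"
proof -
  have "w 0 = 0" using assms(1) odd_zero[of w] by (simp add: signed_perms_def)
  then have "spos (window_inv n w) (int i) = w (int i)" if "i \<le> n" for i
    using spos_window_inv[OF assms(1), of "int i"] that by (cases "i = 0") (auto simp: spos_def)
  moreover have "spos (window_inv n w) (int i + 1) = w (int i + 1)" if "i < n" for i
    using spos_window_inv[OF assms(1), of "int i + 1"] that by simp
  ultimately show ?thesis using assms(2) by (auto simp: DesB_def ldesc_def)
qed

lemma Neg_window_inv:
  assumes "w \<in> signed_perms n"
  shows "Neg n w = nvals (window_inv n w)"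
proof -
  let ?xs = "window_inv n w"
  have sl: "?xs \<in> signed_lists n" using window_inv_signed_lists assms .
  have "w (int i) < 0 \<longleftrightarrow> - int i \<in> set ?xs" if "1 \<le> i" "i \<le> n" for i
  proof -
    have "int i \<in> abs ` set ?xs" using sl that by (simp add: signed_lists_def)
    then obtain y where "y \<in> set ?xs" "int i = \<bar>y\<bar>" by blast
    moreover from this have "y = int i \<or> y = - int i" by linarith
    ultimately have or: "int i \<in> set ?xs \<or> - int i \<in> set ?xs" by blast
    have nand: "\<not> (int i \<in> set ?xs \<and> - int i \<in> set ?xs)"
    proof
      assume a: "int i \<in> set ?xs \<and> - int i \<in> set ?xs"
      have "inj_on abs (set ?xs)" using signed_lists_distinct[OF sl] by (simp only: distinct_map)
      from inj_onD[OF this _ conjunct1[OF a] conjunct2[OF a]] show False using that by simp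
    qed
    have "w (int i) = spos ?xs (int i)" using spos_window_inv[OF assms, of "int i"] that by simp
    also have "\<dots> < 0 \<longleftrightarrow> int i \<notin> set ?xs" using that by (auto simp: spos_def)
    finally show ?thesis using or nand by blast
  qed
  then show ?thesis by (auto simp: Neg_def nvals_def)
qed

lemma window_inv_split:
  assumes "i \<le> n"
  shows "window_inv n w = map (inv w) [1..int i] @ map (inv w) [int i + 1..int n]"
  using assms upto_split2[of 1 "int i" "int n"] by (cases "i = 0") (simp_all add: window_inv_def)

lemma set_take_window_inv: "i \<le> n \<Longrightarrow> set (take i (window_inv n w)) = inv w ` {1..int i}"
  and set_drop_window_inv: "i \<le> n \<Longrightarrow> set (drop i (window_inv n w)) = inv w ` {int i + 1..int n}"
  by (simp_all add: window_inv_split)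

lemma bl_window_inv:
  assumes "n \<ge> 1"
  shows "bl n (inv w) = blocks (window_inv n w)"
proof -
  let ?xs = "window_inv n w"
  define lt where "lt i \<longleftrightarrow> Max (inv w ` {1..int i}) < Min (inv w ` {int i + 1..int n})" for i
  have "lt i \<longleftrightarrow> i \<in> cuts ?xs" if "1 \<le> i" "i \<le> n - 1" for i
  proof -
    have "inv w ` {1..int i} \<noteq> {}" "inv w ` {int i + 1..int n} \<noteq> {}" using that assms by auto
    then have "lt i \<longleftrightarrow> (\<forall>x\<in>inv w ` {1..int i}. \<forall>y\<in>inv w ` {int i + 1..int n}. x < y)"
      unfolding lt_def by (subst Max_less_iff) (auto simp: Min_gr_iff)
    moreover have "i \<le> n" using that by simp
    ultimately show ?thesis
      by (simp add: cuts_def set_take_window_inv set_drop_window_inv)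
  qed
  then have "1 \<le> i \<and> i \<le> n - 1 \<and> lt i \<longleftrightarrow> i \<in> cuts ?xs - {0, n}" for i
    using cuts_bound[of i ?xs] assms by (cases "1 \<le> i \<and> i \<le> n - 1") auto
  then have "{i. 1 \<le> i \<and> i \<le> n - 1 \<and> lt i} = cuts ?xs - {0, n}"
    by blast
  \<comment> \<open>The end cuts 0 and \<open>n\<close> are distinct as \<open>n\<close> is
    positive; dropping both and adding the 1 of \<open>bl\<close> gives the \<open>- 1\<close> of
    \<open>blocks\<close>.\<close>
  moreover have "card (cuts ?xs - {0, n}) = card (cuts ?xs) - card {0, n}"
    using cuts_length[of ?xs] by (intro card_Diff_subset) simp_all
  moreover have "card {0, n} \<le> card (cuts ?xs)"
    using cuts_length[of ?xs] by (intro card_mono) simp_all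
  ultimately show ?thesis using assms by (simp add: bl_def blocks_def lt_def)
qed

text \<open>The last descent sits directly before the last increasing run.\<close>

lemma ldes_window_inv:
  assumes "w \<in> signed_perms n" "n \<ge> 1"
  shows "n - ldes n (inv w) = run (window_inv n w)"
proof -
  let ?xs = "window_inv n w" and ?D = "DesB n (inv w)"
  let ?r = "run ?xs"
  have r: "?r \<le> n" using run_le[of ?xs] by simp
  have D: "Suc i \<in> ?D \<longleftrightarrow> Suc i < n \<and> ?xs ! i > ?xs ! Suc i" for i
    using assms(2) by (auto simp: DesB_def window_inv_nth add.commute)
  have fin: "finite ?D" by (simp add: DesB_def)
  have up: "i \<le> n - ?r" if "i \<in> ?D" for i
  proof (rule ccontr)
    assume a: "\<not> i \<le> n - ?r"
    then obtain k where k: "i = Suc k" by (cases i) auto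
    then have d: "Suc k < n" "?xs ! k > ?xs ! Suc k" using that D by auto
    have "sorted (drop (n - ?r) ?xs)" using le_run_iff[of ?r ?xs] r by simp
    then have "drop (n - ?r) ?xs ! (k - (n - ?r)) \<le> drop (n - ?r) ?xs ! (Suc k - (n - ?r))"
      using a d k by (intro sorted_nth_mono) auto
    then show False using a d k by simp
  qed
  show ?thesis
  proof (cases "?r = n")
    case True
    \<comment> \<open>An increasing list has either no descent or only the sign descent 0;
      \<open>ldes\<close> is 0 in both cases.\<close>
    then have "ldes n (inv w) = 0" using up fin Max_in[of ?D] by (auto simp: ldes_def)
    then show ?thesis using True by simp
  next
    case False
    then have lt: "?r < n" using r by simp
    have r0: "?r > 0" using le_run_iff[of 1 ?xs] assms(2) sorted01[of "drop (n - 1) ?xs"] by simp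
    have "\<not> sorted (drop (n - Suc ?r) ?xs)" using le_run_iff[of "Suc ?r" ?xs] lt by simp
    moreover have "drop (n - Suc ?r) ?xs = ?xs ! (n - Suc ?r) # drop (n - ?r) ?xs"
      using Cons_nth_drop_Suc[of "n - Suc ?r" ?xs] lt by (simp add: Suc_diff_Suc)
    moreover have "drop (n - ?r) ?xs = ?xs ! (n - ?r) # drop (Suc (n - ?r)) ?xs"
      using Cons_nth_drop_Suc[of "n - ?r" ?xs] lt r0 by simp
    moreover have "sorted (drop (n - ?r) ?xs)" using le_run_iff[of ?r ?xs] r by simp
    ultimately have "?xs ! (n - Suc ?r) > ?xs ! (n - ?r)"
      by (metis (no_types, lifting) not_le sorted2)
    then have "n - ?r \<in> ?D" using D[of "n - Suc ?r"] lt r0 by (simp add: Suc_diff_Suc)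
    then have "ldes n (inv w) = n - ?r"
      using up fin by (auto simp: ldes_def intro!: Max_eqI)
    then show ?thesis using lt by simp
  qed
qed

section \<open>Symmetry\<close>

text \<open>
\<open>\<Phi>\<close> sums its argument over a weighted family of pairs \<open>(b, l)\<close>, made of copies of \<open>(m, m)\<close> and of
antidiagonals shifted by \<open>(m, m)\<close>.
\<close>

inductive bal :: "nat \<Rightarrow> ((nat \<Rightarrow> nat \<Rightarrow> 'a::comm_ring_1) \<Rightarrow> 'a) \<Rightarrow> bool" for m where
  zero: "bal m (\<lambda>g. 0)"
| point: "bal m (\<lambda>g. c * g m m)"
| diag: "bal m (\<lambda>g. c * (\<Sum>i=1..s. g (i + m) (s + 1 - i + m)))"
| add: "bal m \<Phi> \<Longrightarrow> bal m \<Psi> \<Longrightarrow> bal m (\<lambda>g. \<Phi> g + \<Psi> g)"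

lemma bal_sum: "(\<And>x. x \<in> A \<Longrightarrow> bal m (\<Phi> x)) \<Longrightarrow> bal m (\<lambda>g. \<Sum>x\<in>A. \<Phi> x g)"
  by (induction A rule: infinite_finite_induct) (auto intro: bal.intros)

text \<open>Reflecting \<open>i\<close> to \<open>s + 1 - i\<close> exchanges the coordinates on
  each antidiagonal, and the point is on the diagonal.\<close>

lemma bal_swap: "bal m \<Phi> \<Longrightarrow> \<Phi> (\<lambda>b l. g l b) = \<Phi> g"
proof (induction rule: bal.induct)
  case (diag c s)
  have "(\<Sum>i=1..s. g (s + 1 - i + m) (i + m)) = (\<Sum>i=1..s. g (i + m) (s + 1 - i + m))"
    by (rule sum.reindex_bij_witness[of _ "\<lambda>i. s + 1 - i" "\<lambda>i. s + 1 - i"]) auto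
  then show ?case by simp
qed auto

text \<open>Corresponds to appending \<open>n + 1\<close>, which raises b, l and m by one
  each.\<close>

lemma bal_shift: "bal m \<Phi> \<Longrightarrow> bal (Suc m) (\<lambda>g. \<Phi> (\<lambda>b l. g (Suc b) (Suc l)))"
proof (induction rule: bal.induct)
  case (diag c s)
  then show ?case using bal.diag[of "Suc m" c s] by simp
qed (auto intro: bal.intros)

text \<open>The combinatorial core, by induction on \<open>s\<close>: passing to
  \<open>s + 1\<close> adds exactly the antidiagonal with \<open>r = m + s + 1\<close>, assembled
  from two pieces.\<close>

lemma diag_insert:
  fixes g :: "nat \<Rightarrow> nat \<Rightarrow> 'a::comm_ring_1"
  shows "(\<Sum>i=1..s. \<Sum>j=1..s + 1 - i + m. g (i + m - min (j - 1) m) j)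
    = (\<Sum>r=m + 1..m + s. \<Sum>i=1..r. g i (r + 1 - i))"
proof (induction s)
  case 0 then show ?case by simp
next
  case (Suc s)
  \<comment> \<open>Every old point has its run one longer and gains one value of \<open>j\<close>.
    There \<open>j - 1\<close> is at least \<open>m\<close>, so the minimum is \<open>m\<close> and
    the new pair starts with \<open>i\<close>.\<close>
  have "(\<Sum>i=1..s. \<Sum>j=1..Suc s + 1 - i + m. g (i + m - min (j - 1) m) j)
     = (\<Sum>i=1..s. (\<Sum>j=1..s + 1 - i + m. g (i + m - min (j - 1) m) j) + g i (m + Suc s + 1 - i))"
  proof (rule sum.cong)
    fix i assume i: "i \<in> {1..s}"
    define k where "k = s + 1 - i + m"
    have k: "Suc s + 1 - i + m = Suc k" "m + Suc s + 1 - i = Suc k" "m \<le> k" using i by (auto simp: k_def)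
    show "(\<Sum>j=1..Suc s + 1 - i + m. g (i + m - min (j - 1) m) j)
      = (\<Sum>j=1..s + 1 - i + m. g (i + m - min (j - 1) m) j) + g i (m + Suc s + 1 - i)"
      unfolding k(1,2) k_def[symmetric] using k(3) by (simp add: min_absorb2)
  qed simp
  also have "\<dots> = (\<Sum>r=m + 1..m + s. \<Sum>i=1..r. g i (r + 1 - i)) + (\<Sum>i=1..s. g i (m + Suc s + 1 - i))"
    using Suc by (simp add: sum.distrib)
  finally have a: "(\<Sum>i=1..s. \<Sum>j=1..Suc s + 1 - i + m. g (i + m - min (j - 1) m) j) = \<dots>" .
  \<comment> \<open>The new point \<open>i = Suc s\<close> has run \<open>m + 1\<close>, so the
    minimum is \<open>j - 1\<close> throughout; it fills the rest of the antidiagonal, from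
    \<open>s + 1\<close> on.\<close>
  have "(\<Sum>j=1..Suc s + 1 - Suc s + m. g (Suc s + m - min (j - 1) m) j)
     = (\<Sum>i=s + 1..m + Suc s. g i (m + Suc s + 1 - i))"
    by (rule sum.reindex_bij_witness[of _ "\<lambda>i. m + Suc s + 1 - i" "\<lambda>i. m + Suc s + 1 - i"])
       (auto intro!: arg_cong2[of _ _ _ _ g])
  moreover have "(\<Sum>i=1..m + Suc s. g i (m + Suc s + 1 - i))
     = (\<Sum>i=1..s. g i (m + Suc s + 1 - i)) + (\<Sum>i=s + 1..m + Suc s. g i (m + Suc s + 1 - i))"
  proof -
    have "{1..m + Suc s} = {1..s} \<union> {s + 1..m + Suc s}" by auto
    then show ?thesis by (simp only:) (intro sum.union_disjoint; auto)
  qed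
  ultimately show ?case using a by (simp add: algebra_simps)
qed

text \<open>Lists obtained by insertion have trail 0, hence the target \<open>bal 0\<close>.\<close>

lemma bal_insert:
  "bal m \<Phi> \<Longrightarrow> bal 0 (\<lambda>g. \<Phi> (\<lambda>b l. \<Sum>j=1..l. g (b - min (j - 1) m) j))"
proof (induction rule: bal.induct)
  case (point c)
  have "(\<Sum>j=1..m. g (m - min (j - 1) m) j) = (\<Sum>i=1..m. g (i + 0) (m + 1 - i + 0))"
    for g :: "nat \<Rightarrow> nat \<Rightarrow> 'a"
    by (rule sum.reindex_bij_witness[of _ "\<lambda>i. m + 1 - i" "\<lambda>i. m + 1 - i"])
       (auto intro!: arg_cong2[of _ _ _ _ g])
  then show ?case using bal.diag[of 0 c m] by simp
next
  case (diag c s)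
  have "bal 0 (\<lambda>g. \<Sum>r=m + 1..m + s. c * (\<Sum>i=1..r. g (i + 0) (r + 1 - i + 0)))"
    by (intro bal_sum bal.diag)
  then show ?case unfolding diag_insert by (simp add: sum_distrib_left)
qed (auto intro: bal.intros)


text \<open>A pair with both entries \<open>Suc m\<close> is the antidiagonal with
  \<open>s = 1\<close>.\<close>

lemma bal_term:
  assumes "b = l" "b = m \<or> b = Suc m"
  shows "bal m (\<lambda>g. c * g b l)"
  using assms bal.point[of m c] bal.diag[of m c 1] by auto

section \<open>Strata by trailing singleton blocks, and the induction along the tree\<close>

definition stratum :: "nat \<Rightarrow> nat \<Rightarrow> int list set" where
  "stratum n m = {xs. good n xs \<and> trail xs = m}"

lemma finite_good: "finite {xs. good n xs}"
proof (rule finite_subset)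
  show "{xs. good n xs} \<subseteq> {xs. set xs \<subseteq> {- int n..int n} \<and> length xs = n}"
  proof
    fix xs assume "xs \<in> {xs. good n xs}"
    then have g: "good n xs" by simp
    have "y \<in> {- int n..int n}" if "y \<in> set xs" for y using good_bound[OF g that] by (auto simp: abs_le_iff)
    then show "xs \<in> {xs. set xs \<subseteq> {- int n..int n} \<and> length xs = n}"
      using good_signed[OF g] by (auto simp: signed_lists_def)
  qed
qed (simp add: finite_lists_length_eq)

lemma good_sorted_strict: "good n (ys @ zs) \<Longrightarrow> sorted zs \<Longrightarrow> sorted_wrt (<) zs"
  using signed_lists_distinct'[OF good_signed, of n "ys @ zs"] by (simp add: strict_sorted_iff)

text \<open>An increasing list has all three statistics equal to its length; the only others are
  covered by \<open>stats_neg_inner\<close>. So these lists contribute terms as in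
  \<open>bal_term\<close>.\<close>

lemma good_negative_stats:
  assumes "good (Suc n) xs" "int n + 1 \<notin> set xs"
  shows "blocks xs = run xs \<and> (blocks xs = trail xs \<or> blocks xs = Suc (trail xs))"
proof -
  have sorted_case: ?thesis if "sorted xs"
    using stats_sorted[OF good_sorted_strict[of "Suc n" "[]" xs]] that assms(1) by simp
  from assms(1) show ?thesis
  proof (cases rule: good.cases)
    case (pos ys zs)
    then show ?thesis using assms(2) by simp
  next
    case (neg_front zs)
    then show ?thesis using sorted_case sorted_Cons_lower[OF good_signed] by blast
  next
    case (neg_inner ys zs)
    show ?thesis
    proof (cases "ys = []")
      case True
      have "good n zs" "sorted zs" using True neg_inner(2) good_upto[of n] by simp_all
      then have "sorted (- (int n + 1) # zs)" using sorted_Cons_lower[OF good_signed] by blast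
      then show ?thesis using sorted_case unfolding neg_inner(1) True append_Nil by blast
    next
      case False
      have "sorted_wrt (<) (ys @ zs)" unfolding neg_inner(2) by (simp add: strict_sorted_iff)
      moreover have "- (int n + 1) < y" if "y \<in> set (ys @ zs)" for y
        using that unfolding neg_inner(2) by simp
      ultimately show ?thesis using stats_neg_inner[of ys zs "- (int n + 1)"] False neg_inner(1) by simp
    qed
  qed
qed

definition insert_max :: "nat \<Rightarrow> nat \<Rightarrow> int list \<Rightarrow> int list" where
  "insert_max n j us = take (n - j) us @ (int n + 1) # drop (n - j) us"

lemma good_length: "good n xs \<Longrightarrow> length xs = n"
  using good_signed by (auto simp: signed_lists_def)

lemma trail_good: "trail ` {xs. good n xs} \<subseteq> {..n}"
proof
  fix k assume "k \<in> trail ` {xs. good n xs}"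
  then obtain xs where "good n xs" "k = trail xs" by auto
  then show "k \<in> {..n}" using trail_le[of xs] good_length[of n xs] by simp
qed

lemma insert_max_facts:
  assumes "good n us" "1 \<le> j" "j \<le> run us"
  shows "good (Suc n) (insert_max n j us)" "trail (insert_max n j us) = 0" "run (insert_max n j us) = j"
    "blocks (insert_max n j us) = blocks us - min (j - 1) (trail us)"
    "key (insert_max n j us) = key_step n (trail us) (key us)"
proof -
  define ys zs where "ys = take (n - j) us" and "zs = drop (n - j) us"
  have us: "ys @ zs = us" by (simp add: ys_def zs_def)
  have len: "length us = n" using good_length assms(1) .
  have j: "j \<le> n" using run_le[of us] len assms(3) by simp
  then have lz: "length zs = j" using len by (simp add: zs_def)
  then have ne: "zs \<noteq> []" using assms(2) by auto
  have s: "sorted zs" using le_run_iff[of j us] j len assms(3) by (simp add: zs_def)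
  have ss: "sorted_wrt (<) zs" using good_sorted_strict[of n ys zs] s us assms(1) by simp
  have lt: "y < int n + 1" if "y \<in> set (ys @ zs)" for y
    using good_bound[OF assms(1), of y] that us by simp
  have e: "insert_max n j us = ys @ (int n + 1) # zs" by (simp add: insert_max_def ys_def zs_def)
  show "good (Suc n) (insert_max n j us)" unfolding e using good.pos s us assms(1) by simp
  show "trail (insert_max n j us) = 0" unfolding e using trail_insert lt ne by blast
  obtain c zs' where zs: "zs = c # zs'" using ne by (cases zs) auto
  show "run (insert_max n j us) = j"
    unfolding e using run_insert[of c "int n + 1" zs' ys] lt[of c] s zs lz by simp
  show "blocks (insert_max n j us) = blocks us - min (j - 1) (trail us)"
    unfolding e using blocks_insert[of ys zs "int n + 1", OF _ ne ss] lt us lz by simp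
  show "key (insert_max n j us) = key_step n (trail us) (key us)"
    unfolding e using key_insert[of ys zs n] good_signed[OF assms(1)] us s ne by simp
qed

lemma snoc_facts:
  assumes "good n us"
  shows "good (Suc n) (us @ [int n + 1])" "trail (us @ [int n + 1]) = Suc (trail us)"
    "run (us @ [int n + 1]) = Suc (run us)" "blocks (us @ [int n + 1]) = Suc (blocks us)"
    "key (us @ [int n + 1]) = key us"
proof -
  have lt: "y < int n + 1" if "y \<in> set us" for y
    using good_bound[OF assms that] by simp
  show "good (Suc n) (us @ [int n + 1])" using good.pos[of n us "[]"] assms by simp
  show "trail (us @ [int n + 1]) = Suc (trail us)"
    "run (us @ [int n + 1]) = Suc (run us)" "blocks (us @ [int n + 1]) = Suc (blocks us)"
    using trail_snoc run_snoc blocks_snoc lt by blast+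
  show "key (us @ [int n + 1]) = key us" using key_snoc good_signed[OF assms] .
qed

lemma good_positive_cases:
  assumes "good (Suc n) xs" "int n + 1 \<in> set xs"
  obtains (snoc) us where "good n us" "xs = us @ [int n + 1]"
  | (insert_max) us j where "good n us" "1 \<le> j" "j \<le> run us" "xs = insert_max n j us"
proof -
  obtain ys zs where xs: "xs = ys @ (int n + 1) # zs" using assms(2) by (meson split_list)
  note g = good_posD[OF assms(1)[unfolded xs]]
  show ?thesis
  proof (cases "zs = []")
    case True
    then show ?thesis using snoc g xs by simp
  next
    case False
    have "n - length zs = length ys" using good_length[OF g(1)] by simp
    then have "xs = insert_max n (length zs) (ys @ zs)" by (simp add: insert_max_def xs)
    moreover have "length zs \<le> run (ys @ zs)" using g(2) by (subst le_run_iff) auto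
    moreover have "1 \<le> length zs" using False by (simp add: Suc_le_eq)
    ultimately show ?thesis using insert_max[OF g(1)] by blast
  qed
qed

lemma stratum_0: "stratum 0 m = (if m = 0 then {[]} else {})"
proof -
  have "good 0 xs \<longleftrightarrow> xs = []" for xs using good_length[of 0 xs] good.Nil by auto
  moreover have "trail [] = 0" using trail_le[of "[]"] by simp
  ultimately show ?thesis unfolding stratum_def by (cases "m = 0") (simp_all cong: conj_cong)
qed

text \<open>Insertion before the end makes the trail 0, so a positive trail forces
  \<open>n + 1\<close> to be the last entry.\<close>

lemma positive_stratum_Suc:
  "{xs \<in> stratum (Suc n) (Suc m). int n + 1 \<in> set xs} = (\<lambda>us. us @ [int n + 1]) ` stratum n m"
proof
  show "{xs \<in> stratum (Suc n) (Suc m). int n + 1 \<in> set xs} \<subseteq> (\<lambda>us. us @ [int n + 1]) ` stratum n m"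
  proof
    fix xs assume "xs \<in> {xs \<in> stratum (Suc n) (Suc m). int n + 1 \<in> set xs}"
    then have xs: "good (Suc n) xs" "int n + 1 \<in> set xs" "trail xs = Suc m" by (auto simp: stratum_def)
    from xs(1,2) show "xs \<in> (\<lambda>us. us @ [int n + 1]) ` stratum n m"
    proof (cases rule: good_positive_cases)
      case (snoc us)
      then show ?thesis using snoc_facts(2)[of n us] xs(3) by (auto simp: stratum_def)
    next
      case (insert_max us j)
      then show ?thesis using insert_max_facts(2)[of n us j] xs(3) by simp
    qed
  qed
  show "(\<lambda>us. us @ [int n + 1]) ` stratum n m \<subseteq> {xs \<in> stratum (Suc n) (Suc m). int n + 1 \<in> set xs}"
    using snoc_facts by (auto simp: stratum_def)
qed

lemma positive_stratum_zero:
  "bij_betw (\<lambda>(us, j). insert_max n j us) (SIGMA us:{us. good n us}. {1..run us})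
     {xs \<in> stratum (Suc n) 0. int n + 1 \<in> set xs}"
proof (rule bij_betwI')
  fix p p' assume p: "p \<in> (SIGMA us:{us. good n us}. {1..run us})"
    "p' \<in> (SIGMA us:{us. good n us}. {1..run us})"
  obtain us j us' j' where pp: "p = (us, j)" "p' = (us', j')" by (cases p; cases p')
  have g: "good n us" "good n us'" "j \<le> n" "j' \<le> n"
    using p pp run_le[of us] run_le[of us'] good_length[of n us] good_length[of n us'] by auto
  have "us = us' \<and> j = j'" if "insert_max n j us = insert_max n j' us'"
  proof -
    \<comment> \<open>The inserted value is new, so both the parent and the depth \<open>j\<close>
      can be read off.\<close>
    have "int n + 1 \<notin> set us'" using good_bound[OF g(2), of "int n + 1"] by auto
    then have "int n + 1 \<notin> set (take (n - j') us' @ drop (n - j') us')" by simp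
    from split_unique[OF that[unfolded insert_max_def] this]
    have e: "take (n - j) us = take (n - j') us'" "drop (n - j) us = drop (n - j') us'" by auto
    have "us = us'" using e by (metis append_take_drop_id)
    moreover have "j = j'" using arg_cong[OF e(2), of length] g good_length[of n] by simp
    ultimately show ?thesis by simp
  qed
  then show "((\<lambda>(us, j). insert_max n j us) p = (\<lambda>(us, j). insert_max n j us) p') = (p = p')"
    using pp by auto
next
  fix p assume "p \<in> (SIGMA us:{us. good n us}. {1..run us})"
  then show "(\<lambda>(us, j). insert_max n j us) p \<in> {xs \<in> stratum (Suc n) 0. int n + 1 \<in> set xs}"
    using insert_max_facts(1,2) by (auto simp: stratum_def) (simp add: insert_max_def)
next
  fix xs assume "xs \<in> {xs \<in> stratum (Suc n) 0. int n + 1 \<in> set xs}"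
  then have xs: "good (Suc n) xs" "int n + 1 \<in> set xs" "trail xs = 0" by (auto simp: stratum_def)
  from xs(1,2) show "\<exists>p\<in>SIGMA us:{us. good n us}. {1..run us}. xs = (\<lambda>(us, j). insert_max n j us) p"
  proof (cases rule: good_positive_cases)
    case (snoc us)
    then show ?thesis using snoc_facts(2)[of n us] xs(3) by simp
  next
    case (insert_max us j)
    then show ?thesis by (intro bexI[of _ "(us, j)"]) auto
  qed
qed

text \<open>Insertion replaces the weight \<open>F\<close> by \<open>F\<close> after
  \<open>key_step n m\<close>, which is a function of the key for fixed \<open>m\<close>; this is
  why the hypothesis ranges over all weights.\<close>

lemma bal_positive_zero:
  fixes F :: "nat set \<times> nat set \<Rightarrow> 'a::comm_ring_1"
  assumes IH: "\<And>m F. bal m (\<lambda>g. \<Sum>us\<in>stratum n m. (F (key us) :: 'a) * g (blocks us) (run us))"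
  shows "bal 0 (\<lambda>g. \<Sum>xs | xs \<in> stratum (Suc n) 0 \<and> int n + 1 \<in> set xs. F (key xs) * g (blocks xs) (run xs))"
proof -
  have "(\<Sum>xs | xs \<in> stratum (Suc n) 0 \<and> int n + 1 \<in> set xs. F (key xs) * g (blocks xs) (run xs))
    = (\<Sum>m\<le>n. \<Sum>us\<in>stratum n m. F (key_step n m (key us)) *
         (\<Sum>j=1..run us. g (blocks us - min (j - 1) m) j))" for g
  proof -
    have "(\<Sum>xs | xs \<in> stratum (Suc n) 0 \<and> int n + 1 \<in> set xs. F (key xs) * g (blocks xs) (run xs))
      = (\<Sum>(us, j)\<in>(SIGMA us:{us. good n us}. {1..run us}).
          F (key (insert_max n j us)) * g (blocks (insert_max n j us)) (run (insert_max n j us)))"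
      using sum.reindex_bij_betw[OF positive_stratum_zero[of n],
          of "\<lambda>xs. F (key xs) * g (blocks xs) (run xs)"]
      by (simp add: case_prod_unfold)
    also have "\<dots> = (\<Sum>(us, j)\<in>(SIGMA us:{us. good n us}. {1..run us}).
          F (key_step n (trail us) (key us)) * g (blocks us - min (j - 1) (trail us)) j)"
      by (rule sum.cong) (auto simp: insert_max_facts)
    also have "\<dots> = (\<Sum>us | good n us. F (key_step n (trail us) (key us)) *
         (\<Sum>j=1..run us. g (blocks us - min (j - 1) (trail us)) j))"
      using finite_good by (subst sum.Sigma[symmetric]) (auto simp: sum_distrib_left)
    \<comment> \<open>Parents of every trail contribute, so they are grouped by trail before
      \<open>bal_insert\<close> applies.\<close>
    also have "\<dots> = (\<Sum>m\<le>n. \<Sum>us\<in>{us \<in> {us. good n us}. trail us = m}. F (key_step n (trail us) (key us)) *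
         (\<Sum>j=1..run us. g (blocks us - min (j - 1) (trail us)) j))"
      by (intro sum.group[symmetric] finite_good trail_good finite_atMost)
    also have "\<dots> = (\<Sum>m\<le>n. \<Sum>us\<in>stratum n m. F (key_step n m (key us)) *
         (\<Sum>j=1..run us. g (blocks us - min (j - 1) m) j))"
      by (intro sum.cong) (auto simp: stratum_def)
    finally show ?thesis .
  qed
  moreover have "bal 0 (\<lambda>g. \<Sum>m\<le>n. \<Sum>us\<in>stratum n m. F (key_step n m (key us)) *
         (\<Sum>j=1..run us. g (blocks us - min (j - 1) m) j))"
    by (intro bal_sum bal_insert[OF IH[of _ "\<lambda>k. F (key_step n _ k)"]])
  ultimately show ?thesis by simp
qed

text \<open>Each stratum is split according to whether \<open>n + 1\<close> or
  \<open>- (n + 1)\<close> occurs. The negative part gives diagonal points; the positive part comes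
  from appending for \<open>m > 0\<close> and from insertion for \<open>m = 0\<close>.\<close>

lemma bal_stratum:
  fixes F :: "nat set \<times> nat set \<Rightarrow> 'a::comm_ring_1"
  shows "bal m (\<lambda>g. \<Sum>xs\<in>stratum n m. F (key xs) * g (blocks xs) (run xs))"
proof (induction n arbitrary: m F)
  case 0
  have "blocks [] = 0" "run [] = 0" by (simp_all add: blocks_def cuts_def)
  then show ?case unfolding stratum_0 by (intro bal_sum bal_term) (auto split: if_splits)
next
  case (Suc n)
  let ?f = "\<lambda>g xs. F (key xs) * g (blocks xs) (run xs)"
  let ?P = "{xs. xs \<in> stratum (Suc n) m \<and> int n + 1 \<in> set xs}"
  let ?Q = "{xs. xs \<in> stratum (Suc n) m \<and> int n + 1 \<notin> set xs}"
  have "finite (stratum (Suc n) m)"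
    by (rule finite_subset[OF _ finite_good[of "Suc n"]]) (auto simp: stratum_def)
  then have "sum (?f g) (?P \<union> ?Q) = sum (?f g) ?P + sum (?f g) ?Q" for g
    by (intro sum.union_disjoint) auto
  moreover have "?P \<union> ?Q = stratum (Suc n) m" by blast
  ultimately have split: "sum (?f g) (stratum (Suc n) m) = sum (?f g) ?P + sum (?f g) ?Q" for g
    by simp
  have Q: "bal m (\<lambda>g. sum (?f g) ?Q)"
    using good_negative_stats by (intro bal_sum bal_term) (auto simp: stratum_def)
  have P: "bal m (\<lambda>g. sum (?f g) ?P)"
  proof (cases m)
    case 0
    show ?thesis unfolding 0 by (rule bal_positive_zero[OF Suc])
  next
    case (Suc k)
    have "sum (?f g) ?P = (\<Sum>us\<in>stratum n k. F (key us) * g (Suc (blocks us)) (Suc (run us)))" for g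
    proof -
      have "sum (?f g) ?P = (\<Sum>us\<in>stratum n k. ?f g (us @ [int n + 1]))"
        unfolding Suc positive_stratum_Suc by (subst sum.reindex) (auto simp: inj_on_def)
      also have "\<dots> = (\<Sum>us\<in>stratum n k. F (key us) * g (Suc (blocks us)) (Suc (run us)))"
        by (intro sum.cong) (auto simp: stratum_def snoc_facts)
      finally show ?thesis .
    qed
    then show ?thesis using bal_shift[OF Suc.IH[of k F]] Suc by simp
  qed
  show ?case unfolding split using bal.add[OF P Q] .
qed

text \<open>The swap invariance of \<open>bal\<close> is applied stratum by stratum.\<close>

lemma good_sum_symmetric:
  fixes F :: "nat set \<times> nat set \<Rightarrow> 'a::comm_ring_1"
  shows "(\<Sum>xs | good n xs. F (key xs) * g (blocks xs) (run xs))
    = (\<Sum>xs | good n xs. F (key xs) * g (run xs) (blocks xs))"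
proof -
  have grp: "(\<Sum>xs | good n xs. F (key xs) * h (blocks xs) (run xs))
    = (\<Sum>m\<le>n. \<Sum>xs\<in>stratum n m. F (key xs) * h (blocks xs) (run xs))" for h :: "nat \<Rightarrow> nat \<Rightarrow> 'a"
  proof -
    have "(\<Sum>xs | good n xs. F (key xs) * h (blocks xs) (run xs))
      = (\<Sum>m\<le>n. \<Sum>xs\<in>{xs \<in> {xs. good n xs}. trail xs = m}. F (key xs) * h (blocks xs) (run xs))"
      by (intro sum.group[symmetric] finite_good trail_good finite_atMost)
    then show ?thesis by (simp add: stratum_def)
  qed
  show ?thesis
    unfolding grp grp[of "\<lambda>b l. g l b"]
    by (rule sum.cong[OF refl]) (rule bal_swap[OF bal_stratum[where n = n and F = F], of g, symmetric])
qed

theorem theorem1p3: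
  fixes n :: nat and x z :: "nat \<Rightarrow> 'a::comm_ring_1" and q t :: 'a
  assumes "n \<ge> 1"
  shows "(\<Sum>w\<in>FC n. (\<Prod>i\<in>DesB n w. x i) * (\<Prod>i\<in>Neg n w. z i)
            * q ^ bl n (inv w) * t ^ (n - ldes n (inv w)))
       = (\<Sum>w\<in>FC n. (\<Prod>i\<in>DesB n w. x i) * (\<Prod>i\<in>Neg n w. z i)
            * q ^ (n - ldes n (inv w)) * t ^ bl n (inv w))"
proof -
  define F where "F k = (\<Prod>i\<in>fst k. x i) * (\<Prod>i\<in>snd k. z i)" for k
  \<comment> \<open>With \<open>h\<close> arbitrary, one transfer to lists serves both sides of the
    identity.\<close>
  have tr: "(\<Sum>w\<in>FC n. (\<Prod>i\<in>DesB n w. x i) * (\<Prod>i\<in>Neg n w. z i) * h (bl n (inv w)) (n - ldes n (inv w)))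
      = (\<Sum>xs | good n xs. F (key xs) * h (blocks xs) (run xs))" for h :: "nat \<Rightarrow> nat \<Rightarrow> 'a"
  proof -
    have "(\<Sum>w\<in>FC n. (\<Prod>i\<in>DesB n w. x i) * (\<Prod>i\<in>Neg n w. z i) * h (bl n (inv w)) (n - ldes n (inv w)))
      = (\<Sum>w\<in>FC n. F (key (window_inv n w)) * h (blocks (window_inv n w)) (run (window_inv n w)))"
    proof (rule sum.cong)
      fix w assume "w \<in> FC n"
      then have w: "w \<in> signed_perms n" by (simp add: FC_def)
      show "(\<Prod>i\<in>DesB n w. x i) * (\<Prod>i\<in>Neg n w. z i) * h (bl n (inv w)) (n - ldes n (inv w))
        = F (key (window_inv n w)) * h (blocks (window_inv n w)) (run (window_inv n w))"
        unfolding F_def key_def fst_conv snd_conv DesB_window_inv[OF w assms] Neg_window_inv[OF w]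
          bl_window_inv[OF assms] ldes_window_inv[OF w assms] ..
    qed simp
    also have "\<dots> = (\<Sum>xs | good n xs. F (key xs) * h (blocks xs) (run xs))"
      by (rule sum.reindex_bij_betw[OF window_inv_FC])
    finally show ?thesis .
  qed
  show ?thesis
    using tr[of "\<lambda>b l. q ^ b * t ^ l"] tr[of "\<lambda>b l. q ^ l * t ^ b"]
      good_sum_symmetric[of F "\<lambda>b l. q ^ b * t ^ l" n]
    by (simp add: mult.assoc)
qed

end
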